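(* Let $n\ge 1$ be an integer, let $\mathbf{Smooth}$ be the cartesian category of Euclidean spaces and smooth maps, and let $\mathbb{R}^{n\times n}\times -$ be the product comonad on $\mathbf{Smooth}$. Then there exists an injective-on-objects, faithful 2-functor $$\kappa:\mathbf{GCNN}_n\longrightarrow \mathbf{Para}_\odot(\mathsf{CoKl}(\mathbb{R}^{n\times n}\times -)).$$
   Context: Notation: $f\,;g$ denotes composition in diagrammatic order (first $f$, then $g$). Matrix spaces $\mathbb{R}^{a\times b}$ are regarded as Euclidean spaces. "2-functor" between bicategories means a homomorphism of bicategories (pseudofunctor). It is "faithful" if it induces faithful functors on hom-categories. **The bicategory $\mathbf{GCNN}_n$.** Objects are the Euclidean spaces $\mathbb{R}^{n\times k}$, one for each $k$. A primitive GCNN layer $\mathbb{R}^{n\times k}\to\mathbb{R}^{n\times k'}$ is a smooth function $f:\mathbb{R}^{k\times k'}\times\mathbb{R}^{n\times n}\times\mathbb{R}^{n\times k}\to\mathbb{R}^{n\times k'}$ of the form $(W,A,X)\mapsto\sigma(AXW)$, where $\sigma$ is a smooth activation function $\mathbb{R}^{k'}\to\mathbb{R}^{k'}$ applied to each of the $n$ rows. A 1-cell $\mathbb{R}^{n\times k}\to\mathbb{R}^{n\times l}$ is a graph convolutional neural network, i.e. a finite sequence of $m\ge 0$ composable primitive GCNN layers $\mathbb{R}^{n\times d_0}\to\mathbb{R}^{n\times d_1}\to\cdots\to\mathbb{R}^{n\times d_m}$ with $d_0=k$, $d_m=l$; it has the parameter space $P=\prod_{i=0}^{m-1}\mathbb{R}^{d_i\times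 d_{i+1}}$ and an implementation $h:P\times\mathbb{R}^{n\times n}\times\mathbb{R}^{n\times k}\to\mathbb{R}^{n\times l}$. Composition of networks is concatenation of sequences; on implementations, the composite of $f$ (parameter space $P$) followed by $g$ (parameter space $P'$) is $$((w,w'),A,X)\mapsto g(w',A,f(w,A,X)),$$ with parameter space $P\times P'$. The implementation of a sequence is obtained from those of its layers by iterating this rule. The identity is the empty sequence ($m=0$), with one-point parameter space and implementation $( *,A,X)\mapsto X$. A 2-cell from a network with parameter space $P'$ and implementation $h'$ to a parallel network with parameter space $P$ and implementation $h$ is a smooth function $r:P'\to P$ such that $(r\times\mathbb{R}^{n\times n}\times\mathbb{R}^{n\times k})\,;h=h'$. Vertical composition of 2-cells is composition of functions, horizontal composition is the cartesian product of functions, and the coherence isomorphisms are the canonical ones of products of parameter spaces. **The product comonad and its CoKleisli category.** For a cartesian category $\mathcal{C}$ and an object $A$, the product comonad $A\times -$ has comultiplication $\Delta_A\times X:A\times X\to A\times A\times X$ (with $\Delta_A$ the diagonal) and counit the projection $\pi_X:A\times X\to X$. $\mathsf{CoKl}(A\times -)$ has the same objects as $\mathcal{C}$; a morphism $X\to Y$ is a morphism $A\times X\to Y$ of $\mathcal{C}$; the composite of $f:A\times X\to Y$ and $g:A\times Y\to Z$ is $(\Delta_A\times X)\,;(A\times f)\,;g$. It is cartesian monoidal, with product $X\times X'$ on objects; the product of $f:A\times X\to Y$ and $g:A\times X'\to Y'$ is $A\times X\times X'\to A\times X\times A\times X'\to Y\times Y'$, the first map duplicating $A$ and permuting factors, the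 second being $f\times g$. There is a functor $\iota:\mathcal{C}\to\mathsf{CoKl}(A\times -)$, identity on objects, with $\iota(f)=\pi_X\,;f$ for $f:X\to Y$. The non-contextual action $\odot$ of $\mathcal{C}$ on $\mathsf{CoKl}(A\times -)$ is $P\odot X=\iota(P)\times X$. **The bicategory $\mathbf{Para}_\odot(\mathsf{CoKl}(A\times -))$.** Objects are the objects of $\mathcal{C}$. A 1-cell $X\to Y$ is a pair $(P,f)$ of an object $P$ of $\mathcal{C}$ and a morphism $f:P\times A\times X\to Y$ of $\mathcal{C}$. A 2-cell $(P',f')\Rightarrow(P,f)$ is a morphism $r:P'\to P$ of $\mathcal{C}$ with $(r\times A\times X)\,;f=f'$. The composite of $(P,f):X\to Y$ and $(Q,g):Y\to Z$ is $(Q\times P,h)$, where $h$ is $$Q\times P\times A\times X\to Q\times P\times A\times A\times X\to Q\times A\times P\times A\times X\xrightarrow{1_{Q\times A}\times f}Q\times A\times Y\xrightarrow{g}Z,$$ the first map using $\Delta_A$ and the second permuting factors. The identity on $X$ is the terminal object with the projection $1\times A\times X\to X$. Vertical composition of 2-cells is composition in $\mathcal{C}$, horizontal composition is the cartesian product, and coherence isomorphisms are those of the cartesian structure. Here $\mathcal{C}=\mathbf{Smooth}$ and $A=\mathbb{R}^{n\times n}$. *)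

theory Defs
  imports "HOL-Analysis.Function_Topology" "Jordan_Normal_Form.Matrix"
begin

section \<open>Arrows and bicategories\<close>

text \<open>An arrow is a datum (its body) tagged with its source and target. All 1-cells, 2-cells and
  morphisms below are tagged in this way, so that hom-sets are disjoint and the operations need no
  extra arguments for boundaries. All composition is in diagrammatic order.\<close>

datatype ('o, 'm) arrow = Arrow (source: 'o) (body: 'm) (target: 'o)

definition homs :: "('o, 'm) arrow set \<Rightarrow> 'o \<Rightarrow> 'o \<Rightarrow> ('o, 'm) arrow set"
  where "homs S a b = {f \<in> S. source f = a \<and> target f = b}"

type_synonym ('o, 'c, 't) cell2 = "(('o, 'c) arrow, 't) arrow"

record ('o, 'c, 't) bicat =
  Obj :: "'o set"
  Cells1 :: "('o, 'c) arrow set"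
  Cells2 :: "('o, 'c, 't) cell2 set"
  id1 :: "'o \<Rightarrow> ('o, 'c) arrow"
  comp1 :: "('o, 'c) arrow \<Rightarrow> ('o, 'c) arrow \<Rightarrow> ('o, 'c) arrow"
  id2 :: "('o, 'c) arrow \<Rightarrow> ('o, 'c, 't) cell2"
  vcomp :: "('o, 'c, 't) cell2 \<Rightarrow> ('o, 'c, 't) cell2 \<Rightarrow> ('o, 'c, 't) cell2"
  hcomp :: "('o, 'c, 't) cell2 \<Rightarrow> ('o, 'c, 't) cell2 \<Rightarrow> ('o, 'c, 't) cell2"
  assoc :: "('o, 'c) arrow \<Rightarrow> ('o, 'c) arrow \<Rightarrow> ('o, 'c) arrow \<Rightarrow> ('o, 'c, 't) cell2"
  lunit :: "('o, 'c) arrow \<Rightarrow> ('o, 'c, 't) cell2"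
  runit :: "('o, 'c) arrow \<Rightarrow> ('o, 'c, 't) cell2"

definition hom1 :: "('o, 'c, 't) bicat \<Rightarrow> 'o \<Rightarrow> 'o \<Rightarrow> ('o, 'c) arrow set"
  where "hom1 B = homs (Cells1 B)"

definition hom2 :: "('o, 'c, 't) bicat \<Rightarrow> ('o, 'c) arrow \<Rightarrow> ('o, 'c) arrow \<Rightarrow> ('o, 'c, 't) cell2 set"
  where "hom2 B = homs (Cells2 B)"

definition iso2 :: "('o, 'c, 't) bicat \<Rightarrow> ('o, 'c) arrow \<Rightarrow> ('o, 'c) arrow \<Rightarrow> ('o, 'c, 't) cell2 set"
  where "iso2 B f g = {r \<in> hom2 B f g. \<exists>s \<in> hom2 B g f.
    vcomp B r s = id2 B f \<and> vcomp B s r = id2 B g}"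

locale bicategory =
  fixes B :: "('o, 'c, 't) bicat"
  assumes cell1_boundary: "f \<in> Cells1 B \<Longrightarrow> source f \<in> Obj B \<and> target f \<in> Obj B"
    and cell2_boundary: "r \<in> Cells2 B \<Longrightarrow> source r \<in> Cells1 B \<and> target r \<in> Cells1 B \<and>
      source (source r) = source (target r) \<and> target (source r) = target (target r)"
    and id1_hom: "a \<in> Obj B \<Longrightarrow> id1 B a \<in> hom1 B a a"
    and comp1_hom: "f \<in> hom1 B a b \<Longrightarrow> g \<in> hom1 B b c \<Longrightarrow> comp1 B f g \<in> hom1 B a c"
    and id2_hom: "f \<in> Cells1 B \<Longrightarrow> id2 B f \<in> hom2 B f f"
    and vcomp_hom: "r \<in> hom2 B f g \<Longrightarrow> s \<in> hom2 B g h \<Longrightarrow> vcomp B r s \<in> hom2 B f h"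
    and vcomp_id_left: "r \<in> hom2 B f g \<Longrightarrow> vcomp B (id2 B f) r = r"
    and vcomp_id_right: "r \<in> hom2 B f g \<Longrightarrow> vcomp B r (id2 B g) = r"
    and vcomp_assoc: "r \<in> hom2 B f g \<Longrightarrow> s \<in> hom2 B g h \<Longrightarrow> t \<in> hom2 B h k \<Longrightarrow>
      vcomp B (vcomp B r s) t = vcomp B r (vcomp B s t)"
    and hcomp_hom: "f \<in> hom1 B a b \<Longrightarrow> g \<in> hom1 B b c \<Longrightarrow>
      r \<in> hom2 B f f' \<Longrightarrow> s \<in> hom2 B g g' \<Longrightarrow> hcomp B r s \<in> hom2 B (comp1 B f g) (comp1 B f' g')"
    and hcomp_id: "f \<in> hom1 B a b \<Longrightarrow> g \<in> hom1 B b c \<Longrightarrow>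
      hcomp B (id2 B f) (id2 B g) = id2 B (comp1 B f g)"
    and interchange: "f \<in> hom1 B a b \<Longrightarrow> g \<in> hom1 B b c \<Longrightarrow>
      r \<in> hom2 B f f' \<Longrightarrow> r' \<in> hom2 B f' f'' \<Longrightarrow> s \<in> hom2 B g g' \<Longrightarrow> s' \<in> hom2 B g' g'' \<Longrightarrow>
      hcomp B (vcomp B r r') (vcomp B s s') = vcomp B (hcomp B r s) (hcomp B r' s')"
    and assoc_iso: "f \<in> hom1 B a b \<Longrightarrow> g \<in> hom1 B b c \<Longrightarrow> h \<in> hom1 B c d \<Longrightarrow>
      assoc B f g h \<in> iso2 B (comp1 B (comp1 B f g) h) (comp1 B f (comp1 B g h))"
    and lunit_iso: "f \<in> hom1 B a b \<Longrightarrow> lunit B f \<in> iso2 B (comp1 B (id1 B a) f) f"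
    and runit_iso: "f \<in> hom1 B a b \<Longrightarrow> runit B f \<in> iso2 B (comp1 B f (id1 B b)) f"
    and assoc_natural: "f \<in> hom1 B a b \<Longrightarrow> g \<in> hom1 B b c \<Longrightarrow> h \<in> hom1 B c d \<Longrightarrow>
      r \<in> hom2 B f f' \<Longrightarrow> s \<in> hom2 B g g' \<Longrightarrow> t \<in> hom2 B h h' \<Longrightarrow>
      vcomp B (hcomp B (hcomp B r s) t) (assoc B f' g' h') =
      vcomp B (assoc B f g h) (hcomp B r (hcomp B s t))"
    and lunit_natural: "f \<in> hom1 B a b \<Longrightarrow> r \<in> hom2 B f f' \<Longrightarrow>
      vcomp B (hcomp B (id2 B (id1 B a)) r) (lunit B f') = vcomp B (lunit B f) r"
    and runit_natural: "f \<in> hom1 B a b \<Longrightarrow> r \<in> hom2 B f f' \<Longrightarrow>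
      vcomp B (hcomp B r (id2 B (id1 B b))) (runit B f') = vcomp B (runit B f) r"
    and pentagon: "f \<in> hom1 B a b \<Longrightarrow> g \<in> hom1 B b c \<Longrightarrow> h \<in> hom1 B c d \<Longrightarrow> k \<in> hom1 B d e \<Longrightarrow>
      vcomp B (assoc B (comp1 B f g) h k) (assoc B f g (comp1 B h k)) =
      vcomp B (hcomp B (assoc B f g h) (id2 B k))
        (vcomp B (assoc B f (comp1 B g h) k) (hcomp B (id2 B f) (assoc B g h k)))"
    and triangle: "f \<in> hom1 B a b \<Longrightarrow> g \<in> hom1 B b c \<Longrightarrow>
      vcomp B (assoc B f (id1 B b) g) (hcomp B (id2 B f) (lunit B g)) =
      hcomp B (runit B f) (id2 B g)"

section \<open>Homomorphisms of bicategories\<close>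

record ('o, 'c, 't, 'p, 'd, 'u) bihom =
  onObj :: "'o \<Rightarrow> 'p"
  onCell1 :: "('o, 'c) arrow \<Rightarrow> ('p, 'd) arrow"
  onCell2 :: "('o, 'c, 't) cell2 \<Rightarrow> ('p, 'd, 'u) cell2"
  compositor :: "('o, 'c) arrow \<Rightarrow> ('o, 'c) arrow \<Rightarrow> ('p, 'd, 'u) cell2"
  unitor :: "'o \<Rightarrow> ('p, 'd, 'u) cell2"

locale pseudofunctor = B: bicategory B + D: bicategory D
  for B :: "('o, 'c, 't) bicat" and D :: "('p, 'd, 'u) bicat"
    and F :: "('o, 'c, 't, 'p, 'd, 'u) bihom" +
  assumes onObj: "a \<in> Obj B \<Longrightarrow> onObj F a \<in> Obj D"
    and onCell1: "f \<in> hom1 B a b \<Longrightarrow> onCell1 F f \<in> hom1 D (onObj F a) (onObj F b)"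
    and onCell2: "r \<in> hom2 B f g \<Longrightarrow> onCell2 F r \<in> hom2 D (onCell1 F f) (onCell1 F g)"
    and onCell2_id: "f \<in> Cells1 B \<Longrightarrow> onCell2 F (id2 B f) = id2 D (onCell1 F f)"
    and onCell2_vcomp: "r \<in> hom2 B f g \<Longrightarrow> s \<in> hom2 B g h \<Longrightarrow>
      onCell2 F (vcomp B r s) = vcomp D (onCell2 F r) (onCell2 F s)"
    and compositor_iso: "f \<in> hom1 B a b \<Longrightarrow> g \<in> hom1 B b c \<Longrightarrow>
      compositor F f g \<in> iso2 D (comp1 D (onCell1 F f) (onCell1 F g)) (onCell1 F (comp1 B f g))"
    and compositor_natural: "f \<in> hom1 B a b \<Longrightarrow> g \<in> hom1 B b c \<Longrightarrow>
      r \<in> hom2 B f f' \<Longrightarrow> s \<in> hom2 B g g' \<Longrightarrow>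
      vcomp D (hcomp D (onCell2 F r) (onCell2 F s)) (compositor F f' g') =
      vcomp D (compositor F f g) (onCell2 F (hcomp B r s))"
    and unitor_iso: "a \<in> Obj B \<Longrightarrow> unitor F a \<in> iso2 D (id1 D (onObj F a)) (onCell1 F (id1 B a))"
    and coherence_assoc: "f \<in> hom1 B a b \<Longrightarrow> g \<in> hom1 B b c \<Longrightarrow> h \<in> hom1 B c d \<Longrightarrow>
      vcomp D (hcomp D (compositor F f g) (id2 D (onCell1 F h)))
        (vcomp D (compositor F (comp1 B f g) h) (onCell2 F (assoc B f g h))) =
      vcomp D (assoc D (onCell1 F f) (onCell1 F g) (onCell1 F h))
        (vcomp D (hcomp D (id2 D (onCell1 F f)) (compositor F g h)) (compositor F f (comp1 B g h)))"
    and coherence_lunit: "f \<in> hom1 B a b \<Longrightarrow>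
      vcomp D (hcomp D (unitor F a) (id2 D (onCell1 F f)))
        (vcomp D (compositor F (id1 B a) f) (onCell2 F (lunit B f))) = lunit D (onCell1 F f)"
    and coherence_runit: "f \<in> hom1 B a b \<Longrightarrow>
      vcomp D (hcomp D (id2 D (onCell1 F f)) (unitor F b))
        (vcomp D (compositor F f (id1 B b)) (onCell2 F (runit B f))) = runit D (onCell1 F f)"

definition injective_on_objects ::
    "('o, 'c, 't) bicat \<Rightarrow> ('o, 'c, 't, 'p, 'd, 'u) bihom \<Rightarrow> bool"
  where "injective_on_objects B F \<longleftrightarrow> inj_on (onObj F) (Obj B)"

definition faithful :: "('o, 'c, 't) bicat \<Rightarrow> ('o, 'c, 't, 'p, 'd, 'u) bihom \<Rightarrow> bool"
  where "faithful B F \<longleftrightarrow> (\<forall>f \<in> Cells1 B. \<forall>g \<in> Cells1 B. inj_on (onCell2 F) (hom2 B f g))"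

section \<open>Parametric maps over the coKleisli category of a product comonad\<close>

text \<open>The data of a category with chosen finite products.\<close>

record ('o, 'm) cartesian =
  Ob :: "'o set"
  Arr :: "('o, 'm) arrow set"
  Idn :: "'o \<Rightarrow> ('o, 'm) arrow"
  Seq :: "('o, 'm) arrow \<Rightarrow> ('o, 'm) arrow \<Rightarrow> ('o, 'm) arrow" (infixl \<open>;;\<index>\<close> 55)
  One :: 'o
  Product :: "'o \<Rightarrow> 'o \<Rightarrow> 'o" (infixr \<open>\<times>\<times>\<index>\<close> 80)
  proj1 :: "'o \<Rightarrow> 'o \<Rightarrow> ('o, 'm) arrow"
  proj2 :: "'o \<Rightarrow> 'o \<Rightarrow> ('o, 'm) arrow"
  pairing :: "('o, 'm) arrow \<Rightarrow> ('o, 'm) arrow \<Rightarrow> ('o, 'm) arrow"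

definition cross ::
    "('o, 'm) cartesian \<Rightarrow> ('o, 'm) arrow \<Rightarrow> ('o, 'm) arrow \<Rightarrow> ('o, 'm) arrow"
  where "cross C f g =
    pairing C (proj1 C (source f) (source g) ;;\<^bsub>C\<^esub> f) (proj2 C (source f) (source g) ;;\<^bsub>C\<^esub> g)"

text \<open>The two structural maps
  \<open>Q \<times> P \<times> A \<times> X \<rightarrow> Q \<times> P \<times> A \<times> A \<times> X \<rightarrow> Q \<times> A \<times> P \<times> A \<times> X\<close>, bracketed as
  \<open>(Q \<times> P) \<times> (A \<times> X)\<close>, \<open>(Q \<times> P) \<times> ((A \<times> A) \<times> X)\<close> and \<open>Q \<times> (A \<times> (P \<times> (A \<times> X)))\<close>.\<close>

definition duplicate ::
    "('o, 'm) cartesian \<Rightarrow> 'o \<Rightarrow> 'o \<Rightarrow> 'o \<Rightarrow> 'o \<Rightarrow> ('o, 'm) arrow"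
  where "duplicate C Q P A X =
    cross C (Idn C (Q \<times>\<times>\<^bsub>C\<^esub> P)) (cross C (pairing C (Idn C A) (Idn C A)) (Idn C X))"

definition permute ::
    "('o, 'm) cartesian \<Rightarrow> 'o \<Rightarrow> 'o \<Rightarrow> 'o \<Rightarrow> 'o \<Rightarrow> ('o, 'm) arrow"
  where "permute C Q P A X =
    (let AA = A \<times>\<times>\<^bsub>C\<^esub> A;
         QP = proj1 C (Q \<times>\<times>\<^bsub>C\<^esub> P) (AA \<times>\<times>\<^bsub>C\<^esub> X);
         AAX = proj2 C (Q \<times>\<times>\<^bsub>C\<^esub> P) (AA \<times>\<times>\<^bsub>C\<^esub> X);
         q = QP ;;\<^bsub>C\<^esub> proj1 C Q P;
         p = QP ;;\<^bsub>C\<^esub> proj2 C Q P;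
         a = AAX ;;\<^bsub>C\<^esub> proj1 C AA X ;;\<^bsub>C\<^esub> proj1 C A A;
         a' = AAX ;;\<^bsub>C\<^esub> proj1 C AA X ;;\<^bsub>C\<^esub> proj2 C A A;
         x = AAX ;;\<^bsub>C\<^esub> proj2 C AA X
     in pairing C q (pairing C a (pairing C p (pairing C a' x))))"

text \<open>A 1-cell \<open>X \<rightarrow> Y\<close> has as its body a pair \<open>(P, f)\<close> with \<open>f : P \<times> (A \<times> X) \<rightarrow> Y\<close>.\<close>

type_synonym ('o, 'm) para1 = "('o, 'o \<times> ('o, 'm) arrow) arrow"
type_synonym ('o, 'm) para2 = "(('o, 'm) para1, ('o, 'm) arrow) arrow"

definition para_param :: "('o, 'm) para1 \<Rightarrow> 'o"
  where "para_param F = fst (body F)"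

definition para_map :: "('o, 'm) para1 \<Rightarrow> ('o, 'm) arrow"
  where "para_map F = snd (body F)"

definition para_cells1 :: "('o, 'm) cartesian \<Rightarrow> 'o \<Rightarrow> ('o, 'm) para1 set"
  where "para_cells1 C A = {Arrow X (P, f) Y | X P f Y.
    X \<in> Ob C \<and> P \<in> Ob C \<and> Y \<in> Ob C \<and> f \<in> homs (Arr C) (P \<times>\<times>\<^bsub>C\<^esub> (A \<times>\<times>\<^bsub>C\<^esub> X)) Y}"

definition para_cells2 :: "('o, 'm) cartesian \<Rightarrow> 'o \<Rightarrow> ('o, 'm) para2 set"
  where "para_cells2 C A = {Arrow F' r F | F' r F.
    F' \<in> para_cells1 C A \<and> F \<in> para_cells1 C A \<and> source F' = source F \<and> target F' = target F \<and>
    r \<in> homs (Arr C) (para_param F') (para_param F) \<and>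
    cross C r (Idn C (A \<times>\<times>\<^bsub>C\<^esub> source F)) ;;\<^bsub>C\<^esub> para_map F = para_map F'}"

definition para_id1 :: "('o, 'm) cartesian \<Rightarrow> 'o \<Rightarrow> 'o \<Rightarrow> ('o, 'm) para1"
  where "para_id1 C A X =
    Arrow X (One C, proj2 C (One C) (A \<times>\<times>\<^bsub>C\<^esub> X) ;;\<^bsub>C\<^esub> proj2 C A X) X"

definition para_comp1 ::
    "('o, 'm) cartesian \<Rightarrow> 'o \<Rightarrow> ('o, 'm) para1 \<Rightarrow> ('o, 'm) para1 \<Rightarrow> ('o, 'm) para1"
  where "para_comp1 C A F G =
    (let X = source F; P = para_param F; Q = para_param G
     in Arrow X
          (Q \<times>\<times>\<^bsub>C\<^esub> P,
           duplicate C Q P A X ;;\<^bsub>C\<^esub> permute C Q P A X ;;\<^bsub>C\<^esub>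
             cross C (Idn C Q) (cross C (Idn C A) (para_map F)) ;;\<^bsub>C\<^esub> para_map G)
          (target G))"

definition para_assoc ::
    "('o, 'm) cartesian \<Rightarrow> 'o \<Rightarrow> ('o, 'm) para1 \<Rightarrow> ('o, 'm) para1 \<Rightarrow> ('o, 'm) para1 \<Rightarrow> ('o, 'm) para2"
  where "para_assoc C A F G H =
    (let P = para_param F; Q = para_param G; R = para_param H;
         QP = proj2 C R (Q \<times>\<times>\<^bsub>C\<^esub> P)
     in Arrow (para_comp1 C A (para_comp1 C A F G) H)
          (pairing C (pairing C (proj1 C R (Q \<times>\<times>\<^bsub>C\<^esub> P)) (QP ;;\<^bsub>C\<^esub> proj1 C Q P)) (QP ;;\<^bsub>C\<^esub> proj2 C Q P))
          (para_comp1 C A F (para_comp1 C A G H)))"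

definition para_cokl ::
    "('o, 'm) cartesian \<Rightarrow> 'o \<Rightarrow> ('o, 'o \<times> ('o, 'm) arrow, ('o, 'm) arrow) bicat"
  where "para_cokl C A = \<lparr>
    Obj = Ob C,
    Cells1 = para_cells1 C A,
    Cells2 = para_cells2 C A,
    id1 = para_id1 C A,
    comp1 = para_comp1 C A,
    id2 = (\<lambda>F. Arrow F (Idn C (para_param F)) F),
    vcomp = (\<lambda>r s. Arrow (source r) (body r ;;\<^bsub>C\<^esub> body s) (target s)),
    hcomp = (\<lambda>r s. Arrow (para_comp1 C A (source r) (source s))
      (cross C (body s) (body r)) (para_comp1 C A (target r) (target s))),
    assoc = para_assoc C A,
    lunit = (\<lambda>F. Arrow (para_comp1 C A (para_id1 C A (source F)) F)
      (proj1 C (para_param F) (One C)) F),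
    runit = (\<lambda>F. Arrow (para_comp1 C A F (para_id1 C A (target F)))
      (proj2 C (One C) (para_param F)) F)\<rparr>"

section \<open>The cartesian category of Euclidean spaces and smooth maps\<close>

text \<open>Continuity of a function on \<open>carrier_vec d\<close>. The map \<^term>\<open>vec d\<close> takes the product space
  of real sequences onto \<open>carrier_vec d\<close> by forgetting all but the first \<open>d\<close> coordinates; it is a
  topological quotient map for the usual topology.\<close>

definition continuous_vec :: "nat \<Rightarrow> (real vec \<Rightarrow> real) \<Rightarrow> bool"
  where "continuous_vec d g \<longleftrightarrow> continuous_on UNIV (\<lambda>x :: nat \<Rightarrow> real. g (vec d x))"

text \<open>\<open>Ck k d g\<close>: all partial derivatives of \<open>g\<close> of order at most \<open>k\<close> exist and are continuous.\<close>

primrec Ck :: "nat \<Rightarrow> nat \<Rightarrow> (real vec \<Rightarrow> real) \<Rightarrow> bool"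
  where
    "Ck 0 d g \<longleftrightarrow> continuous_vec d g"
  | "Ck (Suc k) d g \<longleftrightarrow> continuous_vec d g \<and>
       (\<forall>i<d. \<exists>g'. Ck k d g' \<and> (\<forall>x \<in> carrier_vec d.
          ((\<lambda>t. g (x + t \<cdot>\<^sub>v unit_vec d i)) has_real_derivative g' x) (at 0)))"

definition smooth_maps :: "nat \<Rightarrow> nat \<Rightarrow> (real vec \<Rightarrow> real vec) set"
  where "smooth_maps d e = {f \<in> carrier_vec d \<rightarrow>\<^sub>E carrier_vec e.
    \<forall>j<e. \<forall>k. Ck k d (\<lambda>x. f x $ j)}"

text \<open>The object \<open>d\<close> is the Euclidean space \<open>\<real>\<^sup>d\<close>; the product of \<open>d\<close> and \<open>e\<close> is \<open>d + e\<close>, with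
  concatenation of vectors as pairing.\<close>

definition Smooth :: "(nat, real vec \<Rightarrow> real vec) cartesian"
  where "Smooth = \<lparr>
    Ob = UNIV,
    Arr = {Arrow d f e | d f e. f \<in> smooth_maps d e},
    Idn = (\<lambda>d. Arrow d (\<lambda>x \<in> carrier_vec d. x) d),
    Seq = (\<lambda>f g. Arrow (source f) (compose (carrier_vec (source f)) (body g) (body f)) (target g)),
    One = 0,
    Product = (+),
    proj1 = (\<lambda>d e. Arrow (d + e) (\<lambda>x \<in> carrier_vec (d + e). vec_first x d) d),
    proj2 = (\<lambda>d e. Arrow (d + e) (\<lambda>x \<in> carrier_vec (d + e). vec_last x e) e),
    pairing = (\<lambda>f g. Arrow (source f)
      (\<lambda>x \<in> carrier_vec (source f). body f x @\<^sub>v body g x) (target f + target g))\<rparr>"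

section \<open>Graph convolutional neural networks\<close>

text \<open>A layer from \<open>\<real>\<^bsup>n\<times>k\<^esup>\<close> to \<open>\<real>\<^bsup>n\<times>k'\<^esup>\<close> is the function \<open>(W, A, X) \<mapsto> \<sigma> (A X W)\<close> itself, not the
  activation \<open>\<sigma>\<close>; it is smooth because \<open>\<sigma>\<close> is.\<close>

type_synonym layer = "(nat, real mat \<times> real mat \<times> real mat \<Rightarrow> real mat) arrow"

definition layer_fun :: "nat \<Rightarrow> nat \<Rightarrow> nat \<Rightarrow> (real vec \<Rightarrow> real vec) \<Rightarrow>
    real mat \<times> real mat \<times> real mat \<Rightarrow> real mat"
  where "layer_fun n k k' \<sigma> =
    (\<lambda>(W, A, X) \<in> carrier_mat k k' \<times> carrier_mat n n \<times> carrier_mat n k.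
       mat n k' (\<lambda>(i, j). \<sigma> (row (A * X * W) i) $ j))"

definition layers :: "nat \<Rightarrow> layer set"
  where "layers n = {Arrow k (layer_fun n k k' \<sigma>) k' | k k' \<sigma>. \<sigma> \<in> smooth_maps k' k'}"

fun chain :: "nat \<Rightarrow> layer list \<Rightarrow> nat \<Rightarrow> bool"
  where
    "chain k [] l \<longleftrightarrow> k = l"
  | "chain k (L # Ls) l \<longleftrightarrow> source L = k \<and> chain (target L) Ls l"

type_synonym net = "(nat, layer list) arrow"

definition nets :: "nat \<Rightarrow> net set"
  where "nets n = {Arrow k Ls l | k Ls l. set Ls \<subseteq> layers n \<and> chain k Ls l}"

text \<open>The parameter space of a network is \<open>\<real>\<^sup>p\<close> where \<open>p\<close> is the sum of the sizes of its weight
  matrices, which are stored one after the other, each in row-major order.\<close>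

definition weight_dim :: "layer list \<Rightarrow> nat"
  where "weight_dim Ls = (\<Sum>L\<leftarrow>Ls. source L * target L)"

definition weight_mat :: "nat \<Rightarrow> nat \<Rightarrow> real vec \<Rightarrow> real mat"
  where "weight_mat k k' w = mat k k' (\<lambda>(i, j). w $ (i * k' + j))"

fun implementation :: "layer list \<Rightarrow> real vec \<Rightarrow> real mat \<Rightarrow> real mat \<Rightarrow> real mat"
  where
    "implementation [] w A X = X"
  | "implementation (L # Ls) w A X =
       implementation Ls (vec_last w (weight_dim Ls)) A
         (body L (weight_mat (source L) (target L) (vec_first w (source L * target L)), A, X))"

definition net_dim :: "net \<Rightarrow> nat"
  where "net_dim N = weight_dim (body N)"

definition net_cells2 :: "nat \<Rightarrow> (net, (nat, real vec \<Rightarrow> real vec) arrow) arrow set"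
  where "net_cells2 n = {Arrow N' r N | N' r N.
    N' \<in> nets n \<and> N \<in> nets n \<and> source N' = source N \<and> target N' = target N \<and>
    r \<in> homs (Arr Smooth) (net_dim N') (net_dim N) \<and>
    (\<forall>w \<in> carrier_vec (net_dim N'). \<forall>A \<in> carrier_mat n n. \<forall>X \<in> carrier_mat n (source N).
       implementation (body N) (body r w) A X = implementation (body N') w A X)}"

definition net_comp :: "net \<Rightarrow> net \<Rightarrow> net"
  where "net_comp M N = Arrow (source M) (body M @ body N) (target N)"

text \<open>The object \<open>k\<close> stands for the matrix space \<open>\<real>\<^bsup>n\<times>k\<^esup>\<close>. Concatenation of lists and of weight
  vectors is strictly associative and unital, so the canonical coherence isomorphisms between
  products of parameter spaces are identity maps.\<close>

definition GCNN :: "nat \<Rightarrow> (nat, layer list, (nat, real vec \<Rightarrow> real vec) arrow) bicat"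
  where "GCNN n = \<lparr>
    Obj = UNIV,
    Cells1 = nets n,
    Cells2 = net_cells2 n,
    id1 = (\<lambda>k. Arrow k [] k),
    comp1 = net_comp,
    id2 = (\<lambda>N. Arrow N (Idn Smooth (net_dim N)) N),
    vcomp = (\<lambda>r s. Arrow (source r) (body r ;;\<^bsub>Smooth\<^esub> body s) (target s)),
    hcomp = (\<lambda>r s. Arrow (net_comp (source r) (source s))
      (cross Smooth (body r) (body s)) (net_comp (target r) (target s))),
    assoc = (\<lambda>L M N. Arrow (net_comp (net_comp L M) N)
      (Idn Smooth (net_dim L + net_dim M + net_dim N)) (net_comp L (net_comp M N))),
    lunit = (\<lambda>N. Arrow (net_comp (Arrow (source N) [] (source N)) N)
      (Idn Smooth (net_dim N)) N),
    runit = (\<lambda>N. Arrow (net_comp N (Arrow (target N) [] (target N)))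
      (Idn Smooth (net_dim N)) N)\<rparr>"

end

theory Submission
  imports Defs
begin

text \<open>Flattening matrices in row-major order sends the object \<open>k\<close> to \<open>n * k\<close> and a network to its
  implementation, with the same parameter space. Concatenation of networks stores the weights of the
  first factor first, while the composite of parametric maps has parameter space \<open>Q \<times> P\<close>; so the
  compositor is the exchange of the two blocks of parameters, and the 2-functor is the identity on
  the underlying maps of 2-cells, whence faithful. The bicategory and coherence equations only
  concern structural maps of products. The analytic content is that smooth maps, defined by iterated
  partial derivatives, are closed under composition.\<close>

section \<open>Parametric maps over a cartesian category\<close>

text \<open>Parametric maps are treated over an arbitrary category with finite products, whose laws
  are oriented as rewrite rules: composites nest to the right and pairings move outwards. A
  coherence equation of Para then compares two tuples of projections, and rewriting settles it.
  Networks compose strictly, since lists and weight vectors are concatenated, so the discrepancy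
  between the two bicategories is concentrated in the order of the parameters, and associativity of
  the compositor is a hexagon for block exchanges. For smoothness the obstacle is that the dimension
  is a value and not part of the type \<open>real vec\<close>: continuity is phrased through real
  sequences and derivatives only along coordinate lines. The chain rule therefore has to come from
  continuous partial derivatives, and closure under composition follows by induction on the order.
  The bound n \<ge> 1 is what makes k \<mapsto> n * k injective.\<close>

locale cartesian_category =
  fixes C :: "('o, 'm) cartesian" (structure)
  assumes source_Ob [simp]: "f \<in> Arr C \<Longrightarrow> source f \<in> Ob C"
    and target_Ob [simp]: "f \<in> Arr C \<Longrightarrow> target f \<in> Ob C"
    and Idn_Arr [simp]: "a \<in> Ob C \<Longrightarrow> Idn C a \<in> Arr C"
    and source_Idn [simp]: "a \<in> Ob C \<Longrightarrow> source (Idn C a) = a"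
    and target_Idn [simp]: "a \<in> Ob C \<Longrightarrow> target (Idn C a) = a"
    and Seq_Arr [simp]: "f \<in> Arr C \<Longrightarrow> g \<in> Arr C \<Longrightarrow> target f = source g \<Longrightarrow> f ;; g \<in> Arr C"
    and source_Seq [simp]: "f \<in> Arr C \<Longrightarrow> g \<in> Arr C \<Longrightarrow> target f = source g \<Longrightarrow>
      source (f ;; g) = source f"
    and target_Seq [simp]: "f \<in> Arr C \<Longrightarrow> g \<in> Arr C \<Longrightarrow> target f = source g \<Longrightarrow>
      target (f ;; g) = target g"
    and Seq_assoc [simp]: "f \<in> Arr C \<Longrightarrow> g \<in> Arr C \<Longrightarrow> h \<in> Arr C \<Longrightarrow>
      target f = source g \<Longrightarrow> target g = source h \<Longrightarrow> f ;; g ;; h = f ;; (g ;; h)"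
    and Idn_Seq [simp]: "f \<in> Arr C \<Longrightarrow> a = source f \<Longrightarrow> Idn C a ;; f = f"
    and Seq_Idn [simp]: "f \<in> Arr C \<Longrightarrow> b = target f \<Longrightarrow> f ;; Idn C b = f"
    and One_Ob [simp]: "One C \<in> Ob C"
    and One_terminal: "a \<in> Ob C \<Longrightarrow> \<exists>!f. f \<in> homs (Arr C) a (One C)"
    and Product_Ob [simp]: "a \<in> Ob C \<Longrightarrow> b \<in> Ob C \<Longrightarrow> a \<times>\<times>\<^bsub>C\<^esub> b \<in> Ob C"
    and proj1_Arr [simp]: "a \<in> Ob C \<Longrightarrow> b \<in> Ob C \<Longrightarrow> proj1 C a b \<in> Arr C"
    and source_proj1 [simp]: "a \<in> Ob C \<Longrightarrow> b \<in> Ob C \<Longrightarrow> source (proj1 C a b) = a \<times>\<times>\<^bsub>C\<^esub> b"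
    and target_proj1 [simp]: "a \<in> Ob C \<Longrightarrow> b \<in> Ob C \<Longrightarrow> target (proj1 C a b) = a"
    and proj2_Arr [simp]: "a \<in> Ob C \<Longrightarrow> b \<in> Ob C \<Longrightarrow> proj2 C a b \<in> Arr C"
    and source_proj2 [simp]: "a \<in> Ob C \<Longrightarrow> b \<in> Ob C \<Longrightarrow> source (proj2 C a b) = a \<times>\<times>\<^bsub>C\<^esub> b"
    and target_proj2 [simp]: "a \<in> Ob C \<Longrightarrow> b \<in> Ob C \<Longrightarrow> target (proj2 C a b) = b"
    and pairing_Arr [simp]: "f \<in> Arr C \<Longrightarrow> g \<in> Arr C \<Longrightarrow> source f = source g \<Longrightarrow>
      pairing C f g \<in> Arr C"
    and source_pairing [simp]: "f \<in> Arr C \<Longrightarrow> g \<in> Arr C \<Longrightarrow> source f = source g \<Longrightarrow>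
      source (pairing C f g) = source g"
    and target_pairing [simp]: "f \<in> Arr C \<Longrightarrow> g \<in> Arr C \<Longrightarrow> source f = source g \<Longrightarrow>
      target (pairing C f g) = target f \<times>\<times>\<^bsub>C\<^esub> target g"
    and pairing_proj1 [simp]: "f \<in> Arr C \<Longrightarrow> g \<in> Arr C \<Longrightarrow> source f = source g \<Longrightarrow>
      a = target f \<Longrightarrow> b = target g \<Longrightarrow> pairing C f g ;; proj1 C a b = f"
    and pairing_proj2 [simp]: "f \<in> Arr C \<Longrightarrow> g \<in> Arr C \<Longrightarrow> source f = source g \<Longrightarrow>
      a = target f \<Longrightarrow> b = target g \<Longrightarrow> pairing C f g ;; proj2 C a b = g"
    and pairing_eta [simp]: "f \<in> Arr C \<Longrightarrow> a \<in> Ob C \<Longrightarrow> b \<in> Ob C \<Longrightarrow> target f = a \<times>\<times>\<^bsub>C\<^esub> b \<Longrightarrow>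
      pairing C (f ;; proj1 C a b) (f ;; proj2 C a b) = f"
begin

lemma pairing_proj [simp]:
  "a \<in> Ob C \<Longrightarrow> b \<in> Ob C \<Longrightarrow> pairing C (proj1 C a b) (proj2 C a b) = Idn C (a \<times>\<times>\<^bsub>C\<^esub> b)"
  using pairing_eta[of "Idn C (a \<times>\<times>\<^bsub>C\<^esub> b)" a b] by simp

text \<open>Since \<open>Seq_assoc\<close> nests to the right, a projection followed by a further
  map no longer stands next to its pairing; this and the next lemma restate the projection laws for
  that position.\<close>

lemma pairing_proj1_Seq [simp]:
  "f \<in> Arr C \<Longrightarrow> g \<in> Arr C \<Longrightarrow> h \<in> Arr C \<Longrightarrow> source f = source g \<Longrightarrow> target f = source h \<Longrightarrow>
    a = target f \<Longrightarrow> b = target g \<Longrightarrow> pairing C f g ;; (proj1 C a b ;; h) = f ;; h"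
  by (subst Seq_assoc[symmetric]) (simp_all del: Seq_assoc)

lemma pairing_proj2_Seq [simp]:
  "f \<in> Arr C \<Longrightarrow> g \<in> Arr C \<Longrightarrow> h \<in> Arr C \<Longrightarrow> source f = source g \<Longrightarrow> target g = source h \<Longrightarrow>
    a = target f \<Longrightarrow> b = target g \<Longrightarrow> pairing C f g ;; (proj2 C a b ;; h) = g ;; h"
  by (subst Seq_assoc[symmetric]) (simp_all del: Seq_assoc)

text \<open>Both sides have the same two projections, and \<open>pairing_eta\<close> recovers an
  arrow from its projections.\<close>

lemma Seq_pairing [simp]:
  assumes "f \<in> Arr C" "g \<in> Arr C" "h \<in> Arr C" "target f = source g" "source g = source h"
  shows "f ;; pairing C g h = pairing C (f ;; g) (f ;; h)"
proof -
  have "f ;; pairing C g h ;; proj1 C (target g) (target h) = f ;; g"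
    "f ;; pairing C g h ;; proj2 C (target g) (target h) = f ;; h"
    using assms by simp_all
  moreover have "pairing C (f ;; pairing C g h ;; proj1 C (target g) (target h))
      (f ;; pairing C g h ;; proj2 C (target g) (target h)) = f ;; pairing C g h"
    using assms by (intro pairing_eta) simp_all
  ultimately show ?thesis by simp
qed

lemma Seq_pairing_Seq [simp]:
  "f \<in> Arr C \<Longrightarrow> g \<in> Arr C \<Longrightarrow> h \<in> Arr C \<Longrightarrow> k \<in> Arr C \<Longrightarrow> target f = source g \<Longrightarrow>
    source g = source h \<Longrightarrow> source k = target g \<times>\<times>\<^bsub>C\<^esub> target h \<Longrightarrow>
    f ;; (pairing C g h ;; k) = pairing C (f ;; g) (f ;; h) ;; k"
  by (subst Seq_assoc[symmetric]) (simp_all del: Seq_assoc)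

lemma One_ext: "f \<in> Arr C \<Longrightarrow> g \<in> Arr C \<Longrightarrow> source f = source g \<Longrightarrow>
    target f = One C \<Longrightarrow> target g = One C \<Longrightarrow> f = g"
  using One_terminal[of "source g"] unfolding homs_def
  by (metis (mono_tags, lifting) mem_Collect_eq source_Ob)

lemma cross_eq: "f \<in> Arr C \<Longrightarrow> g \<in> Arr C \<Longrightarrow> cross C f g =
    pairing C (proj1 C (source f) (source g) ;; f) (proj2 C (source f) (source g) ;; g)"
  by (simp add: cross_def)

lemma cross_Arr [simp]:
  "f \<in> Arr C \<Longrightarrow> g \<in> Arr C \<Longrightarrow> cross C f g \<in> Arr C"
  "f \<in> Arr C \<Longrightarrow> g \<in> Arr C \<Longrightarrow> source (cross C f g) = source f \<times>\<times>\<^bsub>C\<^esub> source g"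
  "f \<in> Arr C \<Longrightarrow> g \<in> Arr C \<Longrightarrow> target (cross C f g) = target f \<times>\<times>\<^bsub>C\<^esub> target g"
  by (simp_all add: cross_def)

section \<open>Cells and composition of parametric maps\<close>

lemma para_cells1_iff: "F \<in> para_cells1 C A \<longleftrightarrow> source F \<in> Ob C \<and> target F \<in> Ob C \<and>
    para_param F \<in> Ob C \<and> para_map F \<in> Arr C \<and>
    source (para_map F) = para_param F \<times>\<times>\<^bsub>C\<^esub> A \<times>\<times>\<^bsub>C\<^esub> source F \<and> target (para_map F) = target F"
  by (cases F; cases "body F") (auto simp: para_cells1_def para_param_def para_map_def homs_def)

lemma para_cells1D [simp]:
  assumes "F \<in> para_cells1 C A"
  shows "source F \<in> Ob C" "target F \<in> Ob C" "para_param F \<in> Ob C" "para_map F \<in> Arr C"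
    "source (para_map F) = para_param F \<times>\<times>\<^bsub>C\<^esub> A \<times>\<times>\<^bsub>C\<^esub> source F" "target (para_map F) = target F"
  using assms by (simp_all add: para_cells1_iff)

lemma para_cells2_iff: "r \<in> para_cells2 C A \<longleftrightarrow>
    source r \<in> para_cells1 C A \<and> target r \<in> para_cells1 C A \<and>
    source (source r) = source (target r) \<and> target (source r) = target (target r) \<and>
    body r \<in> Arr C \<and> source (body r) = para_param (source r) \<and>
    target (body r) = para_param (target r) \<and>
    para_map (source r) =
      cross C (body r) (Idn C (A \<times>\<times>\<^bsub>C\<^esub> source (target r))) ;; para_map (target r)"
  by (cases r) (auto simp: para_cells2_def homs_def)

text \<open>With duplication and permutation multiplied out, the composite reads ((q, p), (a, x))
  \<mapsto> g(q, a, f(p, a, x)) in generalised elements; the projections \<open>QP\<close> and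
  \<open>AX\<close> play the part of (q, p) and (a, x).\<close>

lemma para_map_comp1:
  assumes "A \<in> Ob C" "F \<in> para_cells1 C A" "G \<in> para_cells1 C A" "target F = source G"
  defines "P \<equiv> para_param F" and "Q \<equiv> para_param G"
  shows "para_map (para_comp1 C A F G) =
    (let QP = proj1 C (Q \<times>\<times>\<^bsub>C\<^esub> P) (A \<times>\<times>\<^bsub>C\<^esub> source F); AX = proj2 C (Q \<times>\<times>\<^bsub>C\<^esub> P) (A \<times>\<times>\<^bsub>C\<^esub> source F)
     in pairing C (QP ;; proj1 C Q P) (pairing C (AX ;; proj1 C A (source F))
       (pairing C (QP ;; proj2 C Q P) AX ;; para_map F)) ;; para_map G)"
  using assms
  by (simp add: para_comp1_def Let_def para_map_def[of "Arrow _ _ _"]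
      duplicate_def permute_def cross_eq)

lemma para_comp1_simps [simp]:
  "source (para_comp1 C A F G) = source F"
  "target (para_comp1 C A F G) = target G"
  "para_param (para_comp1 C A F G) = para_param G \<times>\<times>\<^bsub>C\<^esub> para_param F"
  by (simp_all add: para_comp1_def para_param_def Let_def)

lemma para_comp1_cells1 [simp]:
  assumes "A \<in> Ob C" "F \<in> para_cells1 C A" "G \<in> para_cells1 C A" "target F = source G"
  shows "para_comp1 C A F G \<in> para_cells1 C A"
  unfolding para_cells1_iff[of "para_comp1 C A F G"]
  using assms by (simp add: para_map_comp1 Let_def)

lemma para_id1_simps [simp]:
  "source (para_id1 C A X) = X"
  "target (para_id1 C A X) = X"
  "para_param (para_id1 C A X) = One C"
  "para_map (para_id1 C A X) = proj2 C (One C) (A \<times>\<times>\<^bsub>C\<^esub> X) ;; proj2 C A X"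
  by (simp_all add: para_id1_def para_param_def para_map_def)

lemma para_id1_cells1 [simp]: "A \<in> Ob C \<Longrightarrow> X \<in> Ob C \<Longrightarrow> para_id1 C A X \<in> para_cells1 C A"
  unfolding para_cells1_iff[of "para_id1 C A X"] by simp

lemmas para_cokl_simps = hom1_def hom2_def homs_def para_cokl_def

lemma para_assoc_simps [simp]:
  "source (para_assoc C A F G H) = para_comp1 C A (para_comp1 C A F G) H"
  "target (para_assoc C A F G H) = para_comp1 C A F (para_comp1 C A G H)"
  by (simp_all add: para_assoc_def Let_def)

lemma body_para_assoc: "body (para_assoc C A F G H) =
    (let P = para_param F; Q = para_param G; R = para_param H; QP = proj2 C R (Q \<times>\<times>\<^bsub>C\<^esub> P)
     in pairing C (pairing C (proj1 C R (Q \<times>\<times>\<^bsub>C\<^esub> P)) (QP ;; proj1 C Q P)) (QP ;; proj2 C Q P))"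
  by (simp add: para_assoc_def Let_def)

text \<open>An invertible reparametrisation needs the triangle in one direction only: composing that
  triangle with the inverse gives the triangle for the inverse.\<close>

lemma para_iso2I:
  assumes A: "A \<in> Ob C" and FG: "F \<in> para_cells1 C A" "G \<in> para_cells1 C A"
    "source F = source G" "target F = target G"
    and r: "r \<in> Arr C" "source r = para_param F" "target r = para_param G"
    and s: "s \<in> Arr C" "source s = para_param G" "target s = para_param F"
    and inv: "r ;; s = Idn C (para_param F)" "s ;; r = Idn C (para_param G)"
    and eq: "cross C r (Idn C (A \<times>\<times>\<^bsub>C\<^esub> source G)) ;; para_map G = para_map F"
  shows "Arrow F r G \<in> iso2 (para_cokl C A) F G"
proof -
  have "cross C s (Idn C (A \<times>\<times>\<^bsub>C\<^esub> source F)) ;; para_map F =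
      (cross C s (Idn C (A \<times>\<times>\<^bsub>C\<^esub> source F)) ;; cross C r (Idn C (A \<times>\<times>\<^bsub>C\<^esub> source G))) ;; para_map G"
    unfolding eq[symmetric] using A FG r s by simp
  also have "cross C s (Idn C (A \<times>\<times>\<^bsub>C\<^esub> source F)) ;; cross C r (Idn C (A \<times>\<times>\<^bsub>C\<^esub> source G)) =
      cross C (s ;; r) (Idn C (A \<times>\<times>\<^bsub>C\<^esub> source G))"
    using A FG r s by (simp add: cross_eq)
  also have "\<dots> = Idn C (para_param G \<times>\<times>\<^bsub>C\<^esub> A \<times>\<times>\<^bsub>C\<^esub> source G)"
    using A FG by (simp add: cross_eq inv)
  finally have "cross C s (Idn C (A \<times>\<times>\<^bsub>C\<^esub> source F)) ;; para_map F = para_map G"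
    using A FG by simp
  then show ?thesis
    using assms unfolding iso2_def
    by (auto simp: para_cokl_simps para_cells2_iff intro!: exI[of _ "Arrow G s F"])
qed

text \<open>After \<open>cross_eq\<close> and \<open>body_para_assoc\<close> each law is an equation
  between tuples of projections. Only invertibility of the coherence cells needs witnesses.\<close>

theorem bicategory_para_cokl:
  assumes A [simp]: "A \<in> Ob C"
  shows "bicategory (para_cokl C A)"
proof
  fix f
  assume "f \<in> Cells1 (para_cokl C A)"
  then show "source f \<in> Obj (para_cokl C A) \<and> target f \<in> Obj (para_cokl C A)"
    by (simp add: para_cokl_def)
next
  fix r
  assume "r \<in> Cells2 (para_cokl C A)"
  then show "source r \<in> Cells1 (para_cokl C A) \<and> target r \<in> Cells1 (para_cokl C A) \<and>
      source (source r) = source (target r) \<and> target (source r) = target (target r)"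
    by (simp add: para_cokl_def para_cells2_iff)
next
  fix a
  assume "a \<in> Obj (para_cokl C A)"
  then show "id1 (para_cokl C A) a \<in> hom1 (para_cokl C A) a a"
    by (simp add: para_cokl_simps)
next
  fix f g a b c
  assume "f \<in> hom1 (para_cokl C A) a b" "g \<in> hom1 (para_cokl C A) b c"
  then show "comp1 (para_cokl C A) f g \<in> hom1 (para_cokl C A) a c"
    by (auto simp: para_cokl_simps)
next
  fix f
  assume "f \<in> Cells1 (para_cokl C A)"
  then show "id2 (para_cokl C A) f \<in> hom2 (para_cokl C A) f f"
    by (simp add: para_cokl_simps para_cells2_iff cross_eq)
next
  fix r s f g h
  assume "r \<in> hom2 (para_cokl C A) f g" "s \<in> hom2 (para_cokl C A) g h"
  then show "vcomp (para_cokl C A) r s \<in> hom2 (para_cokl C A) f h"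
    by (auto simp: para_cokl_simps para_cells2_iff cross_eq)
next
  fix r f g
  assume "r \<in> hom2 (para_cokl C A) f g"
  then show "vcomp (para_cokl C A) (id2 (para_cokl C A) f) r = r"
    "vcomp (para_cokl C A) r (id2 (para_cokl C A) g) = r"
    by (auto simp: para_cokl_simps para_cells2_iff intro: arrow.expand)
next
  fix r s t f g h k
  assume "r \<in> hom2 (para_cokl C A) f g" "s \<in> hom2 (para_cokl C A) g h"
    "t \<in> hom2 (para_cokl C A) h k"
  then show "vcomp (para_cokl C A) (vcomp (para_cokl C A) r s) t =
      vcomp (para_cokl C A) r (vcomp (para_cokl C A) s t)"
    by (auto simp: para_cokl_simps para_cells2_iff)
next
  fix f g a b c r s f' g'
  assume "f \<in> hom1 (para_cokl C A) a b" "g \<in> hom1 (para_cokl C A) b c"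
    "r \<in> hom2 (para_cokl C A) f f'" "s \<in> hom2 (para_cokl C A) g g'"
  then show "hcomp (para_cokl C A) r s \<in>
      hom2 (para_cokl C A) (comp1 (para_cokl C A) f g) (comp1 (para_cokl C A) f' g')"
    by (auto simp: para_cokl_simps para_cells2_iff para_map_comp1 Let_def cross_eq)
next
  fix f g a b c
  assume "f \<in> hom1 (para_cokl C A) a b" "g \<in> hom1 (para_cokl C A) b c"
  then show "hcomp (para_cokl C A) (id2 (para_cokl C A) f) (id2 (para_cokl C A) g) =
      id2 (para_cokl C A) (comp1 (para_cokl C A) f g)"
    by (auto simp: para_cokl_simps cross_eq)
next
  fix f g a b c r r' s s' f' f'' g' g''
  assume "f \<in> hom1 (para_cokl C A) a b" "g \<in> hom1 (para_cokl C A) b c"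
    "r \<in> hom2 (para_cokl C A) f f'" "r' \<in> hom2 (para_cokl C A) f' f''"
    "s \<in> hom2 (para_cokl C A) g g'" "s' \<in> hom2 (para_cokl C A) g' g''"
  then show "hcomp (para_cokl C A) (vcomp (para_cokl C A) r r') (vcomp (para_cokl C A) s s') =
      vcomp (para_cokl C A) (hcomp (para_cokl C A) r s) (hcomp (para_cokl C A) r' s')"
    by (auto simp: para_cokl_simps para_cells2_iff cross_eq)
next
  fix f g h a b c d
  assume fgh: "f \<in> hom1 (para_cokl C A) a b" "g \<in> hom1 (para_cokl C A) b c"
    "h \<in> hom1 (para_cokl C A) c d"
  let ?P = "para_param f" and ?Q = "para_param g" and ?R = "para_param h"
  let ?RQ = "proj1 C (?R \<times>\<times>\<^bsub>C\<^esub> ?Q) ?P"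
  \<comment> \<open>The witness \<open>s\<close> is the opposite rebracketing, from (R \<times> Q)
    \<times> P to R \<times> (Q \<times> P).\<close>
  have "Arrow (para_comp1 C A (para_comp1 C A f g) h) (body (para_assoc C A f g h))
      (para_comp1 C A f (para_comp1 C A g h)) \<in> iso2 (para_cokl C A)
      (para_comp1 C A (para_comp1 C A f g) h) (para_comp1 C A f (para_comp1 C A g h))"
    using fgh
    by (intro para_iso2I[where s = "pairing C (?RQ ;; proj1 C ?R ?Q)
          (pairing C (?RQ ;; proj2 C ?R ?Q) (proj2 C (?R \<times>\<times>\<^bsub>C\<^esub> ?Q) ?P))"])
      (auto simp: para_cokl_simps para_map_comp1 body_para_assoc Let_def cross_eq)
  then show "assoc (para_cokl C A) f g h \<in> iso2 (para_cokl C A)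
      (comp1 (para_cokl C A) (comp1 (para_cokl C A) f g) h)
      (comp1 (para_cokl C A) f (comp1 (para_cokl C A) g h))"
    by (simp add: para_cokl_def para_assoc_def Let_def)
next
  fix f a b
  assume f: "f \<in> hom1 (para_cokl C A) a b"
  then have "para_param f \<in> Ob C"
    by (auto simp: para_cokl_simps)
  \<comment> \<open>The inverse of a projection P \<times> 1 \<rightarrow> P pairs the identity with
    the unique map \<open>u\<close> from P to the terminal object.\<close>
  then obtain u where u [simp]: "u \<in> Arr C" "source u = para_param f" "target u = One C"
    using One_terminal[of "para_param f"] by (auto simp: homs_def)
  \<comment> \<open>The only use of terminality: the component in \<open>One C\<close> of a
    composite must agree with the corresponding projection.\<close>
  have *: "proj1 C (para_param f) (One C) ;; u = proj2 C (para_param f) (One C)"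
    "proj2 C (One C) (para_param f) ;; u = proj1 C (One C) (para_param f)"
    using f by (auto simp: para_cokl_simps intro!: One_ext)
  show "lunit (para_cokl C A) f \<in> iso2 (para_cokl C A)
      (comp1 (para_cokl C A) (id1 (para_cokl C A) a) f) f"
    using f * unfolding para_cokl_def
    by (auto simp: para_cokl_simps para_map_comp1 Let_def cross_eq
        intro!: para_iso2I[unfolded para_cokl_def, where s = "pairing C (Idn C (para_param f)) u"])
  show "runit (para_cokl C A) f \<in> iso2 (para_cokl C A)
      (comp1 (para_cokl C A) f (id1 (para_cokl C A) b)) f"
    using f * unfolding para_cokl_def
    by (auto simp: para_cokl_simps para_map_comp1 Let_def cross_eq
        intro!: para_iso2I[unfolded para_cokl_def, where s = "pairing C u (Idn C (para_param f))"])
next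
  fix f g h a b c d r s t f' g' h'
  assume "f \<in> hom1 (para_cokl C A) a b" "g \<in> hom1 (para_cokl C A) b c"
    "h \<in> hom1 (para_cokl C A) c d" "r \<in> hom2 (para_cokl C A) f f'"
    "s \<in> hom2 (para_cokl C A) g g'" "t \<in> hom2 (para_cokl C A) h h'"
  then show "vcomp (para_cokl C A) (hcomp (para_cokl C A) (hcomp (para_cokl C A) r s) t)
        (assoc (para_cokl C A) f' g' h') =
      vcomp (para_cokl C A) (assoc (para_cokl C A) f g h)
        (hcomp (para_cokl C A) r (hcomp (para_cokl C A) s t))"
    by (auto simp: para_cokl_simps para_cells2_iff body_para_assoc Let_def cross_eq)
next
  fix f a b r f'
  assume "f \<in> hom1 (para_cokl C A) a b" "r \<in> hom2 (para_cokl C A) f f'"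
  then show "vcomp (para_cokl C A)
        (hcomp (para_cokl C A) (id2 (para_cokl C A) (id1 (para_cokl C A) a)) r)
        (lunit (para_cokl C A) f') = vcomp (para_cokl C A) (lunit (para_cokl C A) f) r"
    "vcomp (para_cokl C A)
        (hcomp (para_cokl C A) r (id2 (para_cokl C A) (id1 (para_cokl C A) b)))
        (runit (para_cokl C A) f') = vcomp (para_cokl C A) (runit (para_cokl C A) f) r"
    by (auto simp: para_cokl_simps para_cells2_iff cross_eq)
next
  fix f g h k a b c d e
  assume "f \<in> hom1 (para_cokl C A) a b" "g \<in> hom1 (para_cokl C A) b c"
    "h \<in> hom1 (para_cokl C A) c d" "k \<in> hom1 (para_cokl C A) d e"
  then show "vcomp (para_cokl C A) (assoc (para_cokl C A) (comp1 (para_cokl C A) f g) h k)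
        (assoc (para_cokl C A) f g (comp1 (para_cokl C A) h k)) =
      vcomp (para_cokl C A)
        (hcomp (para_cokl C A) (assoc (para_cokl C A) f g h) (id2 (para_cokl C A) k))
        (vcomp (para_cokl C A) (assoc (para_cokl C A) f (comp1 (para_cokl C A) g h) k)
          (hcomp (para_cokl C A) (id2 (para_cokl C A) f) (assoc (para_cokl C A) g h k)))"
    by (auto simp: para_cokl_simps body_para_assoc Let_def cross_eq)
next
  fix f g a b c
  assume "f \<in> hom1 (para_cokl C A) a b" "g \<in> hom1 (para_cokl C A) b c"
  then show "vcomp (para_cokl C A) (assoc (para_cokl C A) f (id1 (para_cokl C A) b) g)
        (hcomp (para_cokl C A) (id2 (para_cokl C A) f) (lunit (para_cokl C A) g)) =
      hcomp (para_cokl C A) (runit (para_cokl C A) f) (id2 (para_cokl C A) g)"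
    by (auto simp: para_cokl_simps body_para_assoc Let_def cross_eq)
qed

end

lemma para_cokl_fields:
  "Obj (para_cokl C A) = Ob C"
  "id1 (para_cokl C A) = para_id1 C A"
  "comp1 (para_cokl C A) = para_comp1 C A"
  "id2 (para_cokl C A) F = Arrow F (Idn C (para_param F)) F"
  "vcomp (para_cokl C A) r s = Arrow (source r) (body r ;;\<^bsub>C\<^esub> body s) (target s)"
  "hcomp (para_cokl C A) r s = Arrow (para_comp1 C A (source r) (source s))
      (cross C (body s) (body r)) (para_comp1 C A (target r) (target s))"
  "assoc (para_cokl C A) = para_assoc C A"
  "lunit (para_cokl C A) F = Arrow (para_comp1 C A (para_id1 C A (source F)) F)
      (proj1 C (para_param F) (One C)) F"
  "runit (para_cokl C A) F = Arrow (para_comp1 C A F (para_id1 C A (target F)))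
      (proj2 C (One C) (para_param F)) F"
  by (simp_all add: para_cokl_def)

lemma hom1_para_cokl:
  "F \<in> hom1 (para_cokl C A) X Y \<longleftrightarrow> F \<in> para_cells1 C A \<and> source F = X \<and> target F = Y"
  by (auto simp: hom1_def homs_def para_cokl_def)

lemma hom2_para_cokl:
  "r \<in> hom2 (para_cokl C A) F G \<longleftrightarrow> r \<in> para_cells2 C A \<and> source r = F \<and> target r = G"
  by (auto simp: hom2_def homs_def para_cokl_def)

section \<open>Composition of smooth maps\<close>

text \<open>Makes the definition of continuity through sequences usable: limits may be checked
  coordinate by coordinate, because convergence in the product topology is pointwise.\<close>

lemma tendsto_continuous_vec:
  assumes g: "continuous_vec d g" and c: "\<And>t. c t \<in> carrier_vec d" and l: "l \<in> carrier_vec d"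
    and lim: "\<And>j. j < d \<Longrightarrow> ((\<lambda>t. c t $ j) \<longlongrightarrow> l $ j) F"
  shows "((\<lambda>t. g (c t)) \<longlongrightarrow> g l) F"
proof -
  \<comment> \<open>Extension of a vector by zeros; the default 0 is harmless because
    \<open>vec d\<close> forgets these coordinates, so that \<open>vec d (?e v) = v\<close>.\<close>
  let ?e = "\<lambda>v :: real vec. \<lambda>j. if j < d then v $ j else 0"
  have "limitin (product_topology (\<lambda>_. euclidean) UNIV) (\<lambda>t. ?e (c t)) (?e l) F"
    using lim by (auto simp: limitin_componentwise)
  then have "((\<lambda>t. ?e (c t)) \<longlongrightarrow> ?e l) F"
    by (simp add: euclidean_product_topology)
  then have "((\<lambda>t. g (vec d (?e (c t)))) \<longlongrightarrow> g (vec d (?e l))) F"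
    using g unfolding continuous_vec_def
    by (intro continuous_on_tendsto_compose[of UNIV "\<lambda>x. g (vec d x)"]) auto
  moreover have "vec d (?e v) = v" if "v \<in> carrier_vec d" for v
    using that by (intro eq_vecI) auto
  ultimately show ?thesis
    using c l by simp
qed

lemma continuous_vec_compose:
  assumes g: "continuous_vec e g" and f: "f \<in> carrier_vec d \<rightarrow> carrier_vec e"
    and fj: "\<And>j. j < e \<Longrightarrow> continuous_vec d (\<lambda>x. f x $ j)"
  shows "continuous_vec d (\<lambda>x. g (f x))"
  unfolding continuous_vec_def continuous_on_def
  using fj f by (auto simp: continuous_vec_def continuous_on_def intro!: tendsto_continuous_vec[OF g])

section \<open>Partial derivatives and the chain rule\<close>

definition has_partial :: "nat \<Rightarrow> nat \<Rightarrow> (real vec \<Rightarrow> real) \<Rightarrow> (real vec \<Rightarrow> real) \<Rightarrow> bool"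
  where "has_partial d i g g' \<longleftrightarrow> (\<forall>x \<in> carrier_vec d.
    ((\<lambda>t. g (x + t \<cdot>\<^sub>v unit_vec d i)) has_real_derivative g' x) (at 0))"

text \<open>The definition differentiates at 0 only, but at every base point; moving the base point
  along the line reaches every s.\<close>

lemma has_partial_line:
  assumes "has_partial d i g g'" and x: "x \<in> carrier_vec d"
  shows "((\<lambda>t. g (x + t \<cdot>\<^sub>v unit_vec d i)) has_real_derivative g' (x + s \<cdot>\<^sub>v unit_vec d i)) (at s)"
proof -
  have "x + s \<cdot>\<^sub>v unit_vec d i + t \<cdot>\<^sub>v unit_vec d i = x + (t + s) \<cdot>\<^sub>v unit_vec d i" for t
    using x by (intro eq_vecI) (auto simp: algebra_simps)
  moreover have "((\<lambda>t. g (x + s \<cdot>\<^sub>v unit_vec d i + t \<cdot>\<^sub>v unit_vec d i)) has_real_derivative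
      g' (x + s \<cdot>\<^sub>v unit_vec d i)) (at 0)"
    using assms(1)[unfolded has_partial_def, rule_format, of "x + s \<cdot>\<^sub>v unit_vec d i"] x by simp
  ultimately show ?thesis
    using DERIV_shift[of "\<lambda>t. g (x + t \<cdot>\<^sub>v unit_vec d i)" _ 0 s] by simp
qed

text \<open>The weak bound on the intermediate point covers s = 0, and the sign of s decides on
  which interval the one-variable theorem is applied.\<close>

lemma partial_mean_value:
  assumes "has_partial d i g g'" and x: "x \<in> carrier_vec d"
  obtains \<xi> where "\<bar>\<xi>\<bar> \<le> \<bar>s\<bar>"
    "g (x + s \<cdot>\<^sub>v unit_vec d i) - g x = s * g' (x + \<xi> \<cdot>\<^sub>v unit_vec d i)"
proof -
  let ?u = "\<lambda>t. x + t \<cdot>\<^sub>v unit_vec d i"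
  have u0: "?u 0 = x"
    using x by (intro eq_vecI) auto
  note D = has_partial_line[OF assms]
  consider "s = 0" | "s > 0" | "s < 0" by linarith
  then show ?thesis
  proof cases
    case 1
    then show ?thesis using u0 by (intro that[of 0]) auto
  next
    case 2
    then obtain z where "0 < z" "z < s" "g (?u s) - g (?u 0) = (s - 0) * g' (?u z)"
      using MVT2[of 0 s "\<lambda>t. g (?u t)" "\<lambda>t. g' (?u t)"] D by auto
    then show ?thesis using u0 by (intro that[of z]) auto
  next
    case 3
    then obtain z where "s < z" "z < 0" "g (?u 0) - g (?u s) = (0 - s) * g' (?u z)"
      using MVT2[of s 0 "\<lambda>t. g (?u t)" "\<lambda>t. g' (?u t)"] D by auto
    then show ?thesis using u0 by (intro that[of z]) auto
  qed
qed

text \<open>Changing one coordinate at a time and applying the mean value theorem to each change avoids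
  total derivatives.\<close>

lemma chain_rule_vec:
  fixes c :: "real \<Rightarrow> real vec"
  assumes g: "\<And>j. j < d \<Longrightarrow> has_partial d j g (g' j)" "\<And>j. j < d \<Longrightarrow> continuous_vec d (g' j)"
    and c: "\<And>t. c t \<in> carrier_vec d"
    and dc: "\<And>j. j < d \<Longrightarrow> ((\<lambda>t. c t $ j) has_real_derivative c' j) (at 0)"
  shows "((\<lambda>t. g (c t)) has_real_derivative (\<Sum>j<d. g' j (c 0) * c' j)) (at 0)"
proof -
  \<comment> \<open>A hybrid point: coordinates below j have already moved to \<open>c t\<close>,
    the others are still at \<open>c 0\<close>. Hence \<open>m 0 t = c 0\<close>,
    \<open>m d t = c t\<close>, and consecutive points differ along one axis.\<close>
  define m where "m j t = vec d (\<lambda>i. if i < j then c t $ i else c 0 $ i)" for j t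
  define s where "s j t = c t $ j - c 0 $ j" for j t
  have m: "m j t \<in> carrier_vec d" for j t
    by (simp add: m_def)
  have m_Suc: "m (Suc j) t = m j t + s j t \<cdot>\<^sub>v unit_vec d j" if "j < d" for j t
    using that by (intro eq_vecI) (auto simp: m_def s_def less_Suc_eq)
  have m_0: "m 0 t = c 0" and m_d: "m d t = c t" for t
    using c[of 0] c[of t] by (auto simp: m_def intro!: eq_vecI)
  have "\<exists>\<xi>. \<bar>\<xi>\<bar> \<le> \<bar>s j t\<bar> \<and> g (m (Suc j) t) - g (m j t) =
      s j t * g' j (m j t + \<xi> \<cdot>\<^sub>v unit_vec d j)" if "j < d" for j t
    using partial_mean_value[OF g(1)[OF that] m, of "s j t" j t] m_Suc[OF that] by metis
  \<comment> \<open>One intermediate point for each coordinate and each t. Its offset is bounded by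
    the coordinate increment \<open>s j t\<close>, which tends to 0.\<close>
  then obtain \<xi> where \<xi>: "\<And>j t. j < d \<Longrightarrow> \<bar>\<xi> j t\<bar> \<le> \<bar>s j t\<bar>"
    and diff: "\<And>j t. j < d \<Longrightarrow> g (m (Suc j) t) - g (m j t) =
      s j t * g' j (m j t + \<xi> j t \<cdot>\<^sub>v unit_vec d j)"
    by metis
  have c_lim: "((\<lambda>t. c t $ j) \<longlongrightarrow> c 0 $ j) (at 0)" if "j < d" for j
    using DERIV_isCont[OF dc[OF that]] by (simp add: isCont_def)
  have \<xi>_lim: "(\<xi> j \<longlongrightarrow> 0) (at 0)" if "j < d" for j
  proof (rule tendsto_0_le[where K = 1])
    show "(s j \<longlongrightarrow> 0) (at 0)"
      using tendsto_diff[OF c_lim[OF that] tendsto_const[of "c 0 $ j"]] by (simp add: s_def[abs_def])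
    show "\<forall>\<^sub>F t in at 0. norm (\<xi> j t) \<le> norm (s j t) * 1"
      using \<xi>[OF that] by simp
  qed
  \<comment> \<open>The hybrid point and the offset both converge, so continuity of the partial
    derivative carries its value to the limit at \<open>c 0\<close>. Differentiability of
    \<open>g'\<close> is not involved.\<close>
  have "((\<lambda>t. g' j (m j t + \<xi> j t \<cdot>\<^sub>v unit_vec d j)) \<longlongrightarrow> g' j (c 0)) (at 0)" if j: "j < d" for j
  proof (rule tendsto_continuous_vec[OF g(2)[OF j]])
    fix i assume i: "i < d"
    have "((\<lambda>t. if i < j then c t $ i else c 0 $ i) \<longlongrightarrow> c 0 $ i) (at 0)"
      using c_lim[OF i] by (cases "i < j") simp_all
    moreover have "((\<lambda>t. \<xi> j t * unit_vec d j $ i) \<longlongrightarrow> 0) (at 0)"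
      using \<xi>_lim[OF j] by (rule tendsto_mult_left_zero)
    ultimately have "((\<lambda>t. (if i < j then c t $ i else c 0 $ i) + \<xi> j t * unit_vec d j $ i)
        \<longlongrightarrow> c 0 $ i + 0) (at 0)"
      by (rule tendsto_add)
    then show "((\<lambda>t. (m j t + \<xi> j t \<cdot>\<^sub>v unit_vec d j) $ i) \<longlongrightarrow> c 0 $ i) (at 0)"
      using i j by (simp add: m_def)
  qed (use c m in auto)
  moreover have "((\<lambda>t. s j t / t) \<longlongrightarrow> c' j) (at 0)" if "j < d" for j
    using dc[OF that] by (simp add: DERIV_def s_def)
  ultimately have "((\<lambda>t. \<Sum>j<d. g' j (m j t + \<xi> j t \<cdot>\<^sub>v unit_vec d j) * (s j t / t)) \<longlongrightarrow>
      (\<Sum>j<d. g' j (c 0) * c' j)) (at 0)"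
    by (intro tendsto_sum tendsto_mult) auto
  moreover have "(\<Sum>j<d. g' j (m j t + \<xi> j t \<cdot>\<^sub>v unit_vec d j) * (s j t / t)) =
      (g (c t) - g (c 0)) / t" for t
  proof -
    have "g (c t) - g (c 0) = (\<Sum>j<d. g (m (Suc j) t) - g (m j t))"
      using sum_lessThan_telescope[of "\<lambda>j. g (m j t)" d] by (simp add: m_0 m_d)
    then show ?thesis
      by (simp add: diff sum_divide_distrib mult.commute)
  qed
  ultimately show ?thesis
    by (simp add: DERIV_def)
qed

section \<open>Closure properties of functions of class C^k\<close>

lemma Ck_Suc: "Ck (Suc k) d g \<longleftrightarrow> continuous_vec d g \<and> (\<forall>i<d. \<exists>g'. Ck k d g' \<and> has_partial d i g g')"
  by (simp add: has_partial_def)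

declare Ck.simps(2) [simp del]

lemma Ck_continuous: "Ck k d g \<Longrightarrow> continuous_vec d g"
  by (cases k) (auto simp: Ck_Suc)

lemma Ck_SucD: "Ck (Suc k) d g \<Longrightarrow> Ck k d g"
  by (induction k arbitrary: g) (auto simp: Ck_Suc, blast)

lemma continuous_vec_cong:
  "(\<And>x. x \<in> carrier_vec d \<Longrightarrow> g x = h x) \<Longrightarrow> continuous_vec d g \<longleftrightarrow> continuous_vec d h"
  by (simp add: continuous_vec_def)

text \<open>Only values on the carrier matter, as lines through a point of the carrier stay inside
  it; this allows passing between a function and its restriction.\<close>

lemma Ck_cong:
  assumes "\<And>x. x \<in> carrier_vec d \<Longrightarrow> g x = h x"
  shows "Ck k d g \<longleftrightarrow> Ck k d h"
proof -
  have "has_partial d i g g' \<longleftrightarrow> has_partial d i h g'" for i g'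
    using assms by (simp add: has_partial_def)
  then show ?thesis
    using assms continuous_vec_cong[of d g h] by (cases k) (simp_all add: Ck_Suc)
qed

lemma Ck_const: "Ck k d (\<lambda>_. a)"
proof (induction k arbitrary: a)
  case (Suc k)
  have "has_partial d i (\<lambda>_. a) (\<lambda>_. 0)" for i
    by (simp add: has_partial_def)
  then show ?case
    unfolding Ck_Suc using Suc by (auto simp: continuous_vec_def)
qed (simp add: continuous_vec_def)

lemma Ck_index:
  assumes j: "j < d"
  shows "Ck k d (\<lambda>x. x $ j)"
proof -
  have cont: "continuous_vec d (\<lambda>x. x $ j)"
    using j by (simp add: continuous_vec_def)
  have "has_partial d i (\<lambda>x. x $ j) (\<lambda>_. unit_vec d i $ j)" if "i < d" for i
    using j by (auto simp: has_partial_def intro!: derivative_eq_intros)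
  then show ?thesis
    using cont Ck_const by (cases k) (simp_all add: Ck_Suc, blast)
qed

lemma Ck_add: "Ck k d f \<Longrightarrow> Ck k d g \<Longrightarrow> Ck k d (\<lambda>x. f x + g x)"
proof (induction k arbitrary: f g)
  case 0
  then show ?case
    by (simp add: continuous_vec_def continuous_on_add)
next
  case (Suc k)
  show ?case
    unfolding Ck_Suc
  proof (intro conjI allI impI)
    show "continuous_vec d (\<lambda>x. f x + g x)"
      using Suc.prems by (auto dest!: Ck_continuous simp: continuous_vec_def intro: continuous_on_add)
    fix i assume "i < d"
    then obtain f' g' where "Ck k d f'" "has_partial d i f f'" "Ck k d g'" "has_partial d i g g'"
      using Suc.prems unfolding Ck_Suc by blast
    then show "\<exists>h. Ck k d h \<and> has_partial d i (\<lambda>x. f x + g x) h"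
      by (intro exI[of _ "\<lambda>x. f' x + g' x"]) (auto simp: has_partial_def intro: Suc.IH DERIV_add)
  qed
qed

lemma Ck_mult: "Ck k d f \<Longrightarrow> Ck k d g \<Longrightarrow> Ck k d (\<lambda>x. f x * g x)"
proof (induction k arbitrary: f g)
  case 0
  then show ?case
    by (simp add: continuous_vec_def continuous_on_mult)
next
  case (Suc k)
  show ?case
    unfolding Ck_Suc
  proof (intro conjI allI impI)
    show "continuous_vec d (\<lambda>x. f x * g x)"
      using Suc.prems by (auto dest!: Ck_continuous simp: continuous_vec_def intro: continuous_on_mult)
    fix i assume "i < d"
    then obtain f' g' where *: "Ck k d f'" "has_partial d i f f'" "Ck k d g'" "has_partial d i g g'"
      using Suc.prems unfolding Ck_Suc by blast
    have "has_partial d i (\<lambda>x. f x * g x) (\<lambda>x. f' x * g x + g' x * f x)"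
      unfolding has_partial_def
    proof
      fix x :: "real vec" assume x: "x \<in> carrier_vec d"
      then have x0: "x + 0 \<cdot>\<^sub>v unit_vec d i = x"
        by (intro eq_vecI) auto
      have "((\<lambda>t. f (x + t \<cdot>\<^sub>v unit_vec d i)) has_real_derivative f' x) (at 0)"
        "((\<lambda>t. g (x + t \<cdot>\<^sub>v unit_vec d i)) has_real_derivative g' x) (at 0)"
        using * x by (simp_all add: has_partial_def)
      from DERIV_mult[OF this]
      show "((\<lambda>t. f (x + t \<cdot>\<^sub>v unit_vec d i) * g (x + t \<cdot>\<^sub>v unit_vec d i))
          has_real_derivative f' x * g x + g' x * f x) (at 0)"
        by (simp add: x0)
    qed
    \<comment> \<open>The product rule contains \<open>f\<close> and \<open>g\<close> themselves,
      which are therefore lowered from order k + 1 to order k.\<close>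
    moreover have "Ck k d (\<lambda>x. f' x * g x + g' x * f x)"
      using * Suc.prems[THEN Ck_SucD] by (intro Ck_add Suc.IH)
    ultimately show "\<exists>h. Ck k d h \<and> has_partial d i (\<lambda>x. f x * g x) h"
      by (intro exI conjI)
  qed
qed

lemma Ck_sum: "finite I \<Longrightarrow> (\<And>i. i \<in> I \<Longrightarrow> Ck k d (f i)) \<Longrightarrow> Ck k d (\<lambda>x. \<Sum>i\<in>I. f i x)"
  by (induction I rule: finite_induct) (auto intro: Ck_const Ck_add)

text \<open>A partial derivative of the composite is a sum of products of (\<partial>_j g) o f with
  \<partial>_i f_j. The induction hypothesis is applied to the partial derivatives of
  \<open>g\<close>, hence \<open>g\<close> is generalised, while \<open>f\<close> stays fixed and is
  lowered by one order.\<close>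

lemma Ck_compose:
  "Ck k e g \<Longrightarrow> f \<in> carrier_vec d \<rightarrow> carrier_vec e \<Longrightarrow>
    (\<And>j. j < e \<Longrightarrow> Ck k d (\<lambda>x. f x $ j)) \<Longrightarrow> Ck k d (\<lambda>x. g (f x))"
proof (induction k arbitrary: g)
  case 0
  then show ?case
    unfolding Ck.simps by (rule continuous_vec_compose)
next
  case (Suc k)
  show ?case
    unfolding Ck_Suc
  proof (intro conjI allI impI)
    show "continuous_vec d (\<lambda>x. g (f x))"
      using Ck_continuous[OF Suc.prems(1)] Suc.prems(2) Ck_continuous[OF Suc.prems(3)]
      by (rule continuous_vec_compose)
    fix i assume "i < d"
    have "\<forall>j<e. \<exists>h. Ck k e h \<and> has_partial e j g h"
      using Suc.prems(1) by (simp add: Ck_Suc)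
    then obtain g' where g': "\<And>j. j < e \<Longrightarrow> Ck k e (g' j)"
      "\<And>j. j < e \<Longrightarrow> has_partial e j g (g' j)"
      unfolding choice_iff' by blast
    have "\<forall>j<e. \<exists>h. Ck k d h \<and> has_partial d i (\<lambda>x. f x $ j) h"
      using Suc.prems(3) \<open>i < d\<close> by (simp add: Ck_Suc)
    then obtain f' where f': "\<And>j. j < e \<Longrightarrow> Ck k d (f' j)"
      "\<And>j. j < e \<Longrightarrow> has_partial d i (\<lambda>x. f x $ j) (f' j)"
      unfolding choice_iff' by blast
    have "has_partial d i (\<lambda>x. g (f x)) (\<lambda>x. \<Sum>j<e. g' j (f x) * f' j x)"
      unfolding has_partial_def
    proof
      fix x :: "real vec" assume x: "x \<in> carrier_vec d"
      then have x0: "x + 0 \<cdot>\<^sub>v unit_vec d i = x"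
        by (intro eq_vecI) auto
      show "((\<lambda>t. g (f (x + t \<cdot>\<^sub>v unit_vec d i)))
          has_real_derivative (\<Sum>j<e. g' j (f x) * f' j x)) (at 0)"
        using chain_rule_vec[of e g g' "\<lambda>t. f (x + t \<cdot>\<^sub>v unit_vec d i)" "\<lambda>j. f' j x"]
          g'(2) g'(1)[THEN Ck_continuous] f'(2) Suc.prems(2) x
        by (simp add: x0 has_partial_def Pi_iff)
    qed
    moreover have "Ck k d (\<lambda>x. \<Sum>j<e. g' j (f x) * f' j x)"
      by (intro Ck_sum Ck_mult f' Suc.IH[OF g'(1) Suc.prems(2) Ck_SucD[OF Suc.prems(3)]]) simp_all
    ultimately show "\<exists>h. Ck k d h \<and> has_partial d i (\<lambda>x. g (f x)) h"
      by blast
  qed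
qed

section \<open>Smooth maps as a cartesian category\<close>

lemma vec_first_append [simp]: "u \<in> carrier_vec a \<Longrightarrow> vec_first (u @\<^sub>v v) a = u"
  by (intro eq_vecI) (auto simp: vec_first_def)

lemma vec_last_append [simp]: "v \<in> carrier_vec b \<Longrightarrow> vec_last (u @\<^sub>v v) b = v"
  by (intro eq_vecI) (auto simp: vec_last_def)

lemma append_vec_assoc: "(u @\<^sub>v v) @\<^sub>v w = u @\<^sub>v v @\<^sub>v w"
  by (intro eq_vecI) auto

lemma carrier_vec_addE:
  assumes "x \<in> carrier_vec (a + b)"
  obtains u v where "u \<in> carrier_vec a" "v \<in> carrier_vec b" "x = u @\<^sub>v v"
  using assms vec_first_last_append[of x a b] vec_first_carrier vec_last_carrier by metis

lemma Smooth_simps [simp]: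
  "Ob Smooth = UNIV" "One Smooth = 0" "a \<times>\<times>\<^bsub>Smooth\<^esub> b = a + b"
  "source (Idn Smooth a) = a" "target (Idn Smooth a) = a"
  "source (f ;;\<^bsub>Smooth\<^esub> g) = source f" "target (f ;;\<^bsub>Smooth\<^esub> g) = target g"
  "source (proj1 Smooth a b) = a + b" "target (proj1 Smooth a b) = a"
  "source (proj2 Smooth a b) = a + b" "target (proj2 Smooth a b) = b"
  "source (pairing Smooth f g) = source f" "target (pairing Smooth f g) = target f + target g"
  "x \<in> carrier_vec a \<Longrightarrow> body (Idn Smooth a) x = x"
  "x \<in> carrier_vec (source f) \<Longrightarrow> body (f ;;\<^bsub>Smooth\<^esub> g) x = body g (body f x)"
  "x \<in> carrier_vec (a + b) \<Longrightarrow> body (proj1 Smooth a b) x = vec_first x a"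
  "x \<in> carrier_vec (a + b) \<Longrightarrow> body (proj2 Smooth a b) x = vec_last x b"
  "x \<in> carrier_vec (source f) \<Longrightarrow> body (pairing Smooth f g) x = body f x @\<^sub>v body g x"
  by (simp_all add: Smooth_def compose_def)

lemma source_cross_Smooth [simp]: "source (cross Smooth f g) = source f + source g"
  and target_cross_Smooth [simp]: "target (cross Smooth f g) = target f + target g"
  and body_cross_Smooth [simp]: "u \<in> carrier_vec (source f) \<Longrightarrow> v \<in> carrier_vec (source g) \<Longrightarrow>
    body (cross Smooth f g) (u @\<^sub>v v) = body f u @\<^sub>v body g v"
  by (simp_all add: cross_def)

lemma Arr_Smooth_iff: "f \<in> Arr Smooth \<longleftrightarrow> body f \<in> smooth_maps (source f) (target f)"
  by (cases f) (auto simp: Smooth_def)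

lemma body_Smooth_closed [simp]:
  "f \<in> Arr Smooth \<Longrightarrow> target f = b \<Longrightarrow> x \<in> carrier_vec (source f) \<Longrightarrow> body f x \<in> carrier_vec b"
  by (auto simp: Arr_Smooth_iff smooth_maps_def)

text \<open>Bodies of smooth arrows are extensional functions, so agreement on the carrier forces
  equality of the arrows. Equations between arrows become pointwise through this.\<close>

lemma Smooth_ext:
  assumes "f \<in> Arr Smooth" "g \<in> Arr Smooth" "source f = source g" "target f = target g"
    "\<And>x. x \<in> carrier_vec (source g) \<Longrightarrow> body f x = body g x"
  shows "f = g"
proof (rule arrow.expand)
  have "body f = body g"
    using assms by (intro extensionalityI[of _ "carrier_vec (source g)"])
      (auto simp: Arr_Smooth_iff smooth_maps_def PiE_def)
  then show "source f = source g \<and> body f = body g \<and> target f = target g"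
    using assms by simp
qed

lemma restrict_smooth_maps:
  assumes "\<And>x. x \<in> carrier_vec d \<Longrightarrow> f x \<in> carrier_vec e"
    and "\<And>k j. j < e \<Longrightarrow> Ck k d (\<lambda>x. f x $ j)"
  shows "restrict f (carrier_vec d) \<in> smooth_maps d e"
proof -
  have "Ck k d (\<lambda>x. restrict f (carrier_vec d) x $ j)" if "j < e" for k j
    using assms(2)[OF that] by (subst Ck_cong[of d _ "\<lambda>x. f x $ j"]) auto
  then show ?thesis
    using assms(1) by (auto simp: smooth_maps_def)
qed

lemma Ck_vec_first: "i < a \<Longrightarrow> a \<le> d \<Longrightarrow> Ck k d (\<lambda>x. vec_first x a $ i)"
  using Ck_index[of i d k] by (simp add: vec_first_def)

lemma Ck_vec_last: "i < b \<Longrightarrow> b \<le> d \<Longrightarrow> Ck k d (\<lambda>x. vec_last x b $ i)"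
  using Ck_index[of "d - b + i" d k]
  by (subst Ck_cong[of d _ "\<lambda>x. x $ (d - b + i)"]) (auto simp: vec_last_def)

lemma smooth_maps_Ck: "f \<in> smooth_maps d e \<Longrightarrow> j < e \<Longrightarrow> Ck k d (\<lambda>x. f x $ j)"
  by (simp add: smooth_maps_def)

lemma Idn_Smooth_Arr [simp]: "Idn Smooth a \<in> Arr Smooth"
proof -
  have "restrict (\<lambda>x. x) (carrier_vec a) \<in> smooth_maps a a"
    by (rule restrict_smooth_maps) (auto intro: Ck_index)
  then show ?thesis
    by (simp add: Arr_Smooth_iff) (simp add: Smooth_def)
qed

lemma proj1_Smooth_Arr [simp]: "proj1 Smooth a b \<in> Arr Smooth"
proof -
  have "restrict (\<lambda>x. vec_first x a) (carrier_vec (a + b)) \<in> smooth_maps (a + b) a"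
    by (rule restrict_smooth_maps) (auto intro: Ck_vec_first)
  then show ?thesis
    by (simp add: Arr_Smooth_iff) (simp add: Smooth_def)
qed

lemma proj2_Smooth_Arr [simp]: "proj2 Smooth a b \<in> Arr Smooth"
proof -
  have "restrict (\<lambda>x. vec_last x b) (carrier_vec (a + b)) \<in> smooth_maps (a + b) b"
    by (rule restrict_smooth_maps) (auto intro: Ck_vec_last)
  then show ?thesis
    by (simp add: Arr_Smooth_iff) (simp add: Smooth_def)
qed

lemma Seq_Smooth_Arr [simp]:
  assumes fg: "f \<in> Arr Smooth" "g \<in> Arr Smooth" "target f = source g"
  shows "f ;;\<^bsub>Smooth\<^esub> g \<in> Arr Smooth"
proof -
  have fg': "body f \<in> smooth_maps (source f) (source g)" "body g \<in> smooth_maps (source g) (target g)"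
    using fg by (auto simp: Arr_Smooth_iff)
  have fc: "body f \<in> carrier_vec (source f) \<rightarrow> carrier_vec (source g)"
    using fg by auto
  have "restrict (\<lambda>x. body g (body f x)) (carrier_vec (source f)) \<in>
      smooth_maps (source f) (target g)"
  proof (rule restrict_smooth_maps)
    fix k j assume "j < target g"
    then show "Ck k (source f) (\<lambda>x. body g (body f x) $ j)"
      by (rule Ck_compose[OF smooth_maps_Ck[OF fg'(2)] fc smooth_maps_Ck[OF fg'(1)]])
  qed (use fg fc in auto)
  then show ?thesis
    by (simp add: Arr_Smooth_iff) (simp add: Smooth_def compose_def)
qed

lemma pairing_Smooth_Arr [simp]:
  assumes fg: "f \<in> Arr Smooth" "g \<in> Arr Smooth" "source f = source g"
  shows "pairing Smooth f g \<in> Arr Smooth"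
proof -
  have fg': "body f \<in> smooth_maps (source f) (target f)" "body g \<in> smooth_maps (source f) (target g)"
    using fg by (auto simp: Arr_Smooth_iff)
  have dim: "dim_vec (body f x) = target f" "dim_vec (body g x) = target g"
    if "x \<in> carrier_vec (source f)" for x
    using that fg body_Smooth_closed[of f "target f" x] body_Smooth_closed[of g "target g" x] by auto
  have "restrict (\<lambda>x. body f x @\<^sub>v body g x) (carrier_vec (source f)) \<in>
      smooth_maps (source f) (target f + target g)"
  proof (rule restrict_smooth_maps)
    fix k j assume j: "j < target f + target g"
    show "Ck k (source f) (\<lambda>x. (body f x @\<^sub>v body g x) $ j)"
    proof (cases "j < target f")
      case True
      have "Ck k (source f) (\<lambda>x. body f x $ j)"
        using fg'(1) True by (rule smooth_maps_Ck)
      then show ?thesis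
        using Ck_cong[of "source f" "\<lambda>x. (body f x @\<^sub>v body g x) $ j" "\<lambda>x. body f x $ j" k]
          True by (simp add: dim)
    next
      case False
      have "Ck k (source f) (\<lambda>x. body g x $ (j - target f))"
        using fg'(2) by (rule smooth_maps_Ck) (use j False in auto)
      then show ?thesis
        using Ck_cong[of "source f" "\<lambda>x. (body f x @\<^sub>v body g x) $ j"
            "\<lambda>x. body g x $ (j - target f)" k] j False by (simp add: dim)
    qed
  qed (use fg in auto)
  then show ?thesis
    by (simp add: Arr_Smooth_iff) (simp add: Smooth_def)
qed

text \<open>Terminality of the object 0 holds because the empty vector is the only element of
  \<open>carrier_vec 0\<close>; the other laws are checked pointwise.\<close>

interpretation Smooth: cartesian_category Smooth
proof
  fix a :: nat
  define u where "u = Arrow a (restrict (\<lambda>_ :: real vec. vec 0 (\<lambda>_. 0 :: real)) (carrier_vec a)) (0 :: nat)"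
  have "u \<in> Arr Smooth"
    by (simp add: Arr_Smooth_iff u_def restrict_smooth_maps)
  moreover have "f = u" if "f \<in> homs (Arr Smooth) a 0" for f
    using that \<open>u \<in> Arr Smooth\<close>
  proof (intro Smooth_ext)
    fix x :: "real vec" assume "x \<in> carrier_vec (source u)"
    then have "body f x \<in> carrier_vec 0" "body u x \<in> carrier_vec 0"
      using that by (auto simp: homs_def u_def)
    then show "body f x = body u x"
      by (intro eq_vecI) auto
  qed (auto simp: homs_def u_def)
  ultimately show "\<exists>!f. f \<in> homs (Arr Smooth) a (One Smooth)"
    by (intro ex1I[of _ u]) (auto simp: homs_def u_def)
qed (auto intro!: Smooth_ext)

section \<open>The bicategory of graph convolutional networks\<close>

text \<open>An equality on the nose, since the objects (a + b) + c and a + (b + c) coincide and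
  concatenation is associative. It makes the identity associator of networks natural.\<close>

lemma cross_Smooth_assoc:
  assumes "r \<in> Arr Smooth" "s \<in> Arr Smooth" "t \<in> Arr Smooth"
  shows "cross Smooth (cross Smooth r s) t = cross Smooth r (cross Smooth s t)"
proof (rule Smooth_ext)
  fix x :: "real vec" assume "x \<in> carrier_vec (source (cross Smooth r (cross Smooth s t)))"
  then obtain u y where "u \<in> carrier_vec (source r)" "y \<in> carrier_vec (source s + source t)"
    and x: "x = u @\<^sub>v y"
    by (auto elim: carrier_vec_addE)
  moreover from this obtain v w where "v \<in> carrier_vec (source s)" "w \<in> carrier_vec (source t)"
    and y: "y = v @\<^sub>v w"
    by (auto elim: carrier_vec_addE)
  ultimately show "body (cross Smooth (cross Smooth r s) t) x =
      body (cross Smooth r (cross Smooth s t)) x"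
    \<comment> \<open>Instantiated by hand: concatenations are rewritten to right-nested form, in
      which a product with a compound left factor no longer matches.\<close>
    using body_cross_Smooth[of "u @\<^sub>v v" "cross Smooth r s" w t]
      body_cross_Smooth[of u r "v @\<^sub>v w" "cross Smooth s t"]
    by (simp add: append_vec_assoc)
qed (use assms in auto)

lemma append_vec_carrier_0: "u \<in> carrier_vec 0 \<Longrightarrow> u @\<^sub>v v = v" "u \<in> carrier_vec 0 \<Longrightarrow> v @\<^sub>v u = v"
  by (auto intro!: eq_vecI)

lemma cross_Smooth_Idn_0:
  assumes r: "r \<in> Arr Smooth"
  shows "cross Smooth (Idn Smooth 0) r = r" "cross Smooth r (Idn Smooth 0) = r"
proof -
  have nil: "vec 0 f \<in> carrier_vec 0" for f :: "nat \<Rightarrow> real"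
    by simp
  note n = append_vec_carrier_0[OF nil[of "\<lambda>_. 0"]]
  show "cross Smooth (Idn Smooth 0) r = r"
  proof (rule Smooth_ext)
    fix x :: "real vec" assume "x \<in> carrier_vec (source r)"
    then show "body (cross Smooth (Idn Smooth 0) r) x = body r x"
      using body_cross_Smooth[of "vec 0 (\<lambda>_. 0)" "Idn Smooth 0" x r] n(1) nil by simp
  qed (use r in auto)
  show "cross Smooth r (Idn Smooth 0) = r"
  proof (rule Smooth_ext)
    fix x :: "real vec" assume "x \<in> carrier_vec (source r)"
    then show "body (cross Smooth r (Idn Smooth 0)) x = body r x"
      using body_cross_Smooth[of x r "vec 0 (\<lambda>_. 0)" "Idn Smooth 0"] n(2) nil by simp
  qed (use r in auto)
qed

lemma cross_Smooth_Idn [simp]: "cross Smooth (Idn Smooth a) (Idn Smooth b) = Idn Smooth (a + b)"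
  using Smooth.pairing_proj[of a b] by (simp add: Smooth.cross_eq)

lemma cross_Smooth_Seq:
  assumes "r \<in> Arr Smooth" "r' \<in> Arr Smooth" "target r = source r'"
    and "s \<in> Arr Smooth" "s' \<in> Arr Smooth" "target s = source s'"
  shows "cross Smooth (r ;;\<^bsub>Smooth\<^esub> r') (s ;;\<^bsub>Smooth\<^esub> s') =
    cross Smooth r s ;;\<^bsub>Smooth\<^esub> cross Smooth r' s'"
  using assms by (simp add: Smooth.cross_eq)

section \<open>Weights and implementations of networks\<close>

lemma weight_dim_simps [simp]:
  "weight_dim [] = 0"
  "weight_dim (L # Ls) = source L * target L + weight_dim Ls"
  "weight_dim (Ls @ Ms) = weight_dim Ls + weight_dim Ms"
  by (simp_all add: weight_dim_def)

lemma weight_mat_carrier [simp]: "weight_mat k l w \<in> carrier_mat k l"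
  by (simp add: weight_mat_def)

text \<open>The composition rule ((w, w'), A, X) \<mapsto> g(w', A, f(w, A, X)) for networks.
  Peeling off the first layer takes its weights from the front of \<open>w\<close>, leaving the
  block of \<open>Ms\<close> at the end.\<close>

lemma implementation_append:
  "w \<in> carrier_vec (weight_dim Ls) \<Longrightarrow> w' \<in> carrier_vec (weight_dim Ms) \<Longrightarrow>
    implementation (Ls @ Ms) (w @\<^sub>v w') A X = implementation Ms w' A (implementation Ls w A X)"
proof (induction Ls arbitrary: w X)
  case Nil
  then show ?case
    by (simp add: append_vec_carrier_0)
next
  case (Cons L Ls)
  then obtain u v where uv: "u \<in> carrier_vec (source L * target L)" "v \<in> carrier_vec (weight_dim Ls)"
    "w = u @\<^sub>v v"
    by (auto elim: carrier_vec_addE)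
  moreover have "vec_last (u @\<^sub>v v @\<^sub>v w') (weight_dim Ls + weight_dim Ms) = v @\<^sub>v w'"
    using uv Cons.prems by (intro vec_last_append append_carrier_vec)
  ultimately show ?case
    using Cons by (simp add: append_vec_assoc)
qed

lemma chain_append [simp]: "chain k (Ls @ Ms) l \<longleftrightarrow> (\<exists>m. chain k Ls m \<and> chain m Ms l)"
  by (induction Ls arbitrary: k) auto

text \<open>A layer stores the function and not the activation, so an activation is only obtained
  existentially.\<close>

lemma layersE:
  assumes "L \<in> layers n"
  obtains \<sigma> where "\<sigma> \<in> smooth_maps (target L) (target L)"
    "\<And>W A X. W \<in> carrier_mat (source L) (target L) \<Longrightarrow> A \<in> carrier_mat n n \<Longrightarrow>
      X \<in> carrier_mat n (source L) \<Longrightarrow>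
      body L (W, A, X) = mat n (target L) (\<lambda>(i, j). \<sigma> (row (A * X * W) i) $ j)"
  using assms by (auto simp: layers_def layer_fun_def)

lemma implementation_carrier:
  "set Ls \<subseteq> layers n \<Longrightarrow> chain k Ls l \<Longrightarrow> A \<in> carrier_mat n n \<Longrightarrow> X \<in> carrier_mat n k \<Longrightarrow>
    implementation Ls w A X \<in> carrier_mat n l"
proof (induction Ls arbitrary: k w X)
  case (Cons L Ls)
  then obtain \<sigma> where "body L (weight_mat (source L) (target L) v, A, X) =
      mat n (target L) (\<lambda>(i, j). \<sigma> (row (A * X * weight_mat (source L) (target L) v) i) $ j)" for v
    by (auto elim!: layersE)
  then show ?case
    using Cons by (simp add: Cons.IH[of "target L"])
qed auto

lemma net_comp_simps [simp]:
  "source (net_comp M N) = source M" "target (net_comp M N) = target N"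
  "body (net_comp M N) = body M @ body N" "net_dim (net_comp M N) = net_dim M + net_dim N"
  by (simp_all add: net_comp_def net_dim_def)

lemma net_comp_assoc: "net_comp (net_comp L M) N = net_comp L (net_comp M N)"
  by (simp add: net_comp_def)

lemma net_comp_id:
  "a = source N \<Longrightarrow> net_comp (Arrow a [] a) N = N"
  "a = target N \<Longrightarrow> net_comp N (Arrow a [] a) = N"
  by (cases N; simp add: net_comp_def)+

lemma nets_iff: "N \<in> nets n \<longleftrightarrow> set (body N) \<subseteq> layers n \<and> chain (source N) (body N) (target N)"
  by (cases N) (auto simp: nets_def)

lemma net_comp_nets [simp]:
  "M \<in> nets n \<Longrightarrow> N \<in> nets n \<Longrightarrow> target M = source N \<Longrightarrow> net_comp M N \<in> nets n"
  by (auto simp: nets_iff)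

lemma id_nets [simp]: "Arrow k [] k \<in> nets n" "net_dim (Arrow k [] k) = 0"
  by (simp_all add: nets_iff net_dim_def)

lemma net_implementation_carrier:
  "N \<in> nets n \<Longrightarrow> A \<in> carrier_mat n n \<Longrightarrow> X \<in> carrier_mat n (source N) \<Longrightarrow>
    implementation (body N) w A X \<in> carrier_mat n (target N)"
  by (auto simp: nets_iff intro: implementation_carrier)

lemma net_cells2_iff: "r \<in> net_cells2 n \<longleftrightarrow>
    source r \<in> nets n \<and> target r \<in> nets n \<and> source (source r) = source (target r) \<and>
    target (source r) = target (target r) \<and> body r \<in> Arr Smooth \<and>
    source (body r) = net_dim (source r) \<and> target (body r) = net_dim (target r) \<and>
    (\<forall>w \<in> carrier_vec (net_dim (source r)). \<forall>A \<in> carrier_mat n n.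
      \<forall>X \<in> carrier_mat n (source (target r)).
      implementation (body (target r)) (body (body r) w) A X = implementation (body (source r)) w A X)"
  by (cases r) (auto simp: net_cells2_def homs_def)

lemma hom1_GCNN: "f \<in> hom1 (GCNN n) a b \<longleftrightarrow> f \<in> nets n \<and> source f = a \<and> target f = b"
  by (auto simp: hom1_def homs_def GCNN_def)

lemma hom2_GCNN: "r \<in> hom2 (GCNN n) f g \<longleftrightarrow> r \<in> net_cells2 n \<and> source r = f \<and> target r = g"
  by (auto simp: hom2_def homs_def GCNN_def)

text \<open>The last three equations turn the coherence cells into identity 2-cells, which is
  legitimate because \<open>net_comp\<close> is strictly associative and unital.\<close>

lemma GCNN_simps:
  "Obj (GCNN n) = UNIV" "Cells1 (GCNN n) = nets n" "Cells2 (GCNN n) = net_cells2 n"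
  "id1 (GCNN n) = (\<lambda>k. Arrow k [] k)" "comp1 (GCNN n) = net_comp"
  "id2 (GCNN n) N = Arrow N (Idn Smooth (net_dim N)) N"
  "vcomp (GCNN n) r s = Arrow (source r) (body r ;;\<^bsub>Smooth\<^esub> body s) (target s)"
  "hcomp (GCNN n) r s = Arrow (net_comp (source r) (source s))
      (cross Smooth (body r) (body s)) (net_comp (target r) (target s))"
  "assoc (GCNN n) f g h = id2 (GCNN n) (net_comp f (net_comp g h))"
  "lunit (GCNN n) N = id2 (GCNN n) N"
  "runit (GCNN n) N = id2 (GCNN n) N"
  by (simp_all add: GCNN_def net_comp_assoc net_comp_id add.assoc)

lemma id2_GCNN_hom: "N \<in> nets n \<Longrightarrow> Arrow N (Idn Smooth (net_dim N)) N \<in> net_cells2 n"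
  by (simp add: net_cells2_iff)

lemma id2_GCNN_iso: "N \<in> nets n \<Longrightarrow> Arrow N (Idn Smooth (net_dim N)) N \<in> iso2 (GCNN n) N N"
  unfolding iso2_def
  by (auto simp: hom2_GCNN id2_GCNN_hom GCNN_simps
      intro!: bexI[of _ "Arrow N (Idn Smooth (net_dim N)) N"])

text \<open>Each 2-cell leaves the implementation unchanged, so the second network receives the same
  intermediate matrix before and after reparametrisation.\<close>

lemma hcomp_GCNN_hom:
  assumes rs: "r \<in> net_cells2 n" "s \<in> net_cells2 n" "target (source r) = source (source s)"
  shows "hcomp (GCNN n) r s \<in> net_cells2 n"
proof -
  have "implementation (body (target r) @ body (target s)) (body (cross Smooth (body r) (body s)) w) A X =
      implementation (body (source r) @ body (source s)) w A X"
    if w: "w \<in> carrier_vec (net_dim (source r) + net_dim (source s))"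
      and A: "A \<in> carrier_mat n n" and X: "X \<in> carrier_mat n (source (target r))" for w A X
  proof -
    from w obtain u v where uv: "u \<in> carrier_vec (net_dim (source r))"
      "v \<in> carrier_vec (net_dim (source s))" "w = u @\<^sub>v v"
      by (rule carrier_vec_addE)
    \<comment> \<open>The intermediate matrix between the two networks; its shape is needed to apply
      the equation of \<open>s\<close>.\<close>
    define Y where "Y = implementation (body (source r)) u A X"
    have "Y \<in> carrier_mat n (source (target s))"
      using net_implementation_carrier[of "source r" n A X u] rs A X
      by (simp add: Y_def net_cells2_iff)
    moreover have "implementation (body (target r)) (body (body r) u) A X = Y"
      using rs uv A X by (auto simp: net_cells2_iff Y_def)
    moreover have "body (body r) u \<in> carrier_vec (weight_dim (body (target r)))"
      "body (body s) v \<in> carrier_vec (weight_dim (body (target s)))"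
      using rs uv by (simp_all add: net_cells2_iff flip: net_dim_def)
    ultimately show ?thesis
      using rs uv A X by (simp add: implementation_append net_cells2_iff net_dim_def flip: Y_def)
  qed
  then show ?thesis
    using rs by (simp add: GCNN_simps net_cells2_iff)
qed

text \<open>A strict 2-category: coherence cells are invertible as identities, their naturality is
  strict associativity and unitality of \<open>cross Smooth\<close>, and pentagon and triangle
  compare identities.\<close>

theorem bicategory_GCNN: "bicategory (GCNN n)"
proof (unfold_locales, goal_cases)
  case (3 a)
  then show ?case
    by (simp add: hom1_GCNN GCNN_simps)
next
  case (6 r f g s h)
  then show ?case
    by (auto simp: hom2_GCNN GCNN_simps net_cells2_iff)
next
  case (10 f a b g c r f' s g')
  then show ?case
    using hcomp_GCNN_hom[of r n s] by (auto simp: hom1_GCNN hom2_GCNN GCNN_simps)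
next
  case (12 f a b g c r f' r' f'' s g' s' g'')
  then show ?case
    by (auto simp: hom1_GCNN hom2_GCNN GCNN_simps net_cells2_iff cross_Smooth_Seq)
next
  case (13 f a b g c h d)
  then show ?case
    using id2_GCNN_iso[of "net_comp f (net_comp g h)" n]
    by (auto simp: hom1_GCNN GCNN_simps net_comp_assoc)
next
  case (14 f a b)
  then show ?case
    using id2_GCNN_iso[of f n] by (auto simp: hom1_GCNN GCNN_simps net_comp_id)
next
  case (15 f a b)
  then show ?case
    using id2_GCNN_iso[of f n] by (auto simp: hom1_GCNN GCNN_simps net_comp_id)
next
  case (16 f a b g c h d r f' s g' t h')
  then show ?case
    by (auto simp: hom1_GCNN hom2_GCNN GCNN_simps net_cells2_iff net_comp_assoc cross_Smooth_assoc add.assoc)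
next
  case (17 f a b r f')
  then show ?case
    by (auto simp: hom1_GCNN hom2_GCNN GCNN_simps net_cells2_iff net_comp_id cross_Smooth_Idn_0)
next
  case (18 f a b r f')
  then show ?case
    by (auto simp: hom1_GCNN hom2_GCNN GCNN_simps net_cells2_iff net_comp_id cross_Smooth_Idn_0)
qed (auto simp: hom1_GCNN hom2_GCNN GCNN_simps net_cells2_iff id2_GCNN_hom net_comp_assoc net_comp_id
    add.assoc intro: arrow.expand)

section \<open>Networks as parametric maps\<close>

text \<open>Inverse to \<open>weight_mat\<close>, which below also unflattens the matrices A and X
  and not only weights.\<close>

definition mat_vec :: "nat \<Rightarrow> nat \<Rightarrow> real mat \<Rightarrow> real vec"
  where "mat_vec k l M = vec (k * l) (\<lambda>i. M $$ (i div l, i mod l))"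

lemma mat_vec_carrier [simp]: "mat_vec k l M \<in> carrier_vec (k * l)"
  by (simp add: mat_vec_def)

lemma row_major_less:
  assumes "i < k" "j < l"
  shows "i * l + j < k * (l :: nat)"
proof -
  have "i * l + j < Suc i * l"
    using assms by simp
  also have "\<dots> \<le> k * l"
    using assms by (intro mult_right_mono) auto
  finally show ?thesis .
qed

lemma row_major_bounds:
  assumes "i < k * (l :: nat)"
  shows "i div l < k" "i mod l < l"
proof -
  have "l > 0"
    using assms by (cases l) auto
  then show "i div l < k" "i mod l < l"
    using assms by (auto simp: less_mult_imp_div_less)
qed

lemma weight_mat_mat_vec [simp]: "M \<in> carrier_mat k l \<Longrightarrow> weight_mat k l (mat_vec k l M) = M"
  by (intro eq_matI) (auto simp: weight_mat_def mat_vec_def row_major_less)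

lemma Ck_mat_mult:
  assumes "\<And>x. A x \<in> carrier_mat a b" "\<And>x. B x \<in> carrier_mat b c"
    and "\<And>i j. i < a \<Longrightarrow> j < b \<Longrightarrow> Ck k d (\<lambda>x. A x $$ (i, j))"
    and "\<And>i j. i < b \<Longrightarrow> j < c \<Longrightarrow> Ck k d (\<lambda>x. B x $$ (i, j))"
    and ij: "i < a" "j < c"
  shows "Ck k d (\<lambda>x. (A x * B x) $$ (i, j))"
proof -
  have dim: "dim_row (A x) = a" "dim_col (A x) = b" "dim_row (B x) = b" "dim_col (B x) = c" for x
    using assms(1,2)[of x] by auto
  have "(A x * B x) $$ (i, j) = (\<Sum>q\<in>{0..<b}. A x $$ (i, q) * B x $$ (q, j))" for x
    using ij dim[of x] by (simp add: scalar_prod_def)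
  then show ?thesis
    using assms by (auto intro!: Ck_sum Ck_mult)
qed

text \<open>Weights, graph matrix and features are families depending on a parameter x. The
  induction needs this generality: after one layer the feature matrix is itself a function of x, and
  the weights are a tail of the old ones.\<close>

lemma Ck_implementation:
  "set Ls \<subseteq> layers n \<Longrightarrow> chain a Ls b \<Longrightarrow>
    (\<And>x. w x \<in> carrier_vec (weight_dim Ls)) \<Longrightarrow>
    (\<And>i. i < weight_dim Ls \<Longrightarrow> Ck k d (\<lambda>x. w x $ i)) \<Longrightarrow>
    (\<And>x. A x \<in> carrier_mat n n) \<Longrightarrow>
    (\<And>i j. i < n \<Longrightarrow> j < n \<Longrightarrow> Ck k d (\<lambda>x. A x $$ (i, j))) \<Longrightarrow>
    (\<And>x. X x \<in> carrier_mat n a) \<Longrightarrow>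
    (\<And>i j. i < n \<Longrightarrow> j < a \<Longrightarrow> Ck k d (\<lambda>x. X x $$ (i, j))) \<Longrightarrow>
    i < n \<Longrightarrow> j < b \<Longrightarrow> Ck k d (\<lambda>x. implementation Ls (w x) (A x) (X x) $$ (i, j))"
proof (induction Ls arbitrary: a w X)
  case Nil
  then show ?case
    by simp
next
  case (Cons L Ls)
  note [simp] = Cons.prems(3,5,7)
  have L: "L \<in> layers n" "source L = a"
    using Cons.prems(1,2) by auto
  define W where "W x = weight_mat a (target L) (vec_first (w x) (a * target L))" for x
  define Z where "Z x = A x * X x * W x" for x
  have W [simp]: "W x \<in> carrier_mat a (target L)" for x
    by (simp add: W_def)
  have Z [simp]: "Z x \<in> carrier_mat n (target L)" for x
    unfolding Z_def by (intro mult_carrier_mat[of _ n a] mult_carrier_mat[of _ n n]) simp_all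
  have dim_Z: "dim_row (Z x) = n" "dim_col (Z x) = target L" for x
    using Z[of x] by (simp_all only: carrier_matD)
  obtain \<sigma> where \<sigma>: "\<sigma> \<in> smooth_maps (target L) (target L)"
    and L_eq: "body L (W x, A x, X x) = mat n (target L) (\<lambda>(i, j). \<sigma> (row (Z x) i) $ j)" for x
    using layersE[OF L(1)] L(2) W Cons.prems(5,7) unfolding Z_def by metis
  have Ck_W: "Ck k d (\<lambda>x. W x $$ (i, j))" if "i < a" "j < target L" for i j
    using Cons.prems(4)[of "i * target L + j"] row_major_less[OF that] L that
    by (simp add: W_def weight_mat_def vec_first_def)
  have Ck_Z: "Ck k d (\<lambda>x. Z x $$ (i, j))" if "i < n" "j < target L" for i j
    unfolding Z_def using that Cons.prems(6,8) Ck_W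
    by (intro Ck_mat_mult[of _ n a _ "target L"] Ck_mat_mult[of _ n n _ a] mult_carrier_mat[of _ n n])
      simp_all
  \<comment> \<open>Each entry is a component of the activation composed with a row of the matrix
    \<open>Z x\<close>, to which closure under composition applies.\<close>
  have Ck_L: "Ck k d (\<lambda>x. body L (W x, A x, X x) $$ (i, j))" if "i < n" "j < target L" for i j
  proof -
    have "Ck k d (\<lambda>x. row (Z x) i $ j')" if "j' < target L" for j'
      using Ck_Z[OF \<open>i < n\<close> that] that \<open>i < n\<close> by (simp add: dim_Z)
    moreover have "(\<lambda>x. row (Z x) i) \<in> carrier_vec d \<rightarrow> carrier_vec (target L)"
      by (auto simp: dim_Z intro!: carrier_vecI)
    ultimately have "Ck k d (\<lambda>x. \<sigma> (row (Z x) i) $ j)"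
      by (intro Ck_compose[OF smooth_maps_Ck[OF \<sigma> \<open>j < target L\<close>]])
    then show ?thesis
      using that by (simp add: L_eq)
  qed
  have dim_w: "dim_vec (w x) = a * target L + weight_dim Ls" for x
    using Cons.prems(3)[of x] L by simp
  have "Ck k d (\<lambda>x. vec_last (w x) (weight_dim Ls) $ i)" if "i < weight_dim Ls" for i
    using that Cons.prems(4)[of "a * target L + i"] L by (simp add: vec_last_def dim_w)
  then have "Ck k d (\<lambda>x. implementation Ls (vec_last (w x) (weight_dim Ls)) (A x)
      (body L (W x, A x, X x)) $$ (i, j))"
    using Cons.prems Ck_L by (intro Cons.IH[of "target L"]) (auto simp: L_eq)
  then show ?case
    using L by (simp add: W_def)
qed

text \<open>The implementation in coordinates. The input is laid out as weights, then A, then X,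
  which is the bracketing P \<times> (A \<times> X) of a parametric map.\<close>

definition net_fun :: "nat \<Rightarrow> net \<Rightarrow> (nat, real vec \<Rightarrow> real vec) arrow"
  where "net_fun n N = (let d = n * n + n * source N in
    Arrow (net_dim N + d)
      (\<lambda>x \<in> carrier_vec (net_dim N + d). mat_vec n (target N)
        (implementation (body N) (vec_first x (net_dim N))
          (weight_mat n n (vec_first (vec_last x d) (n * n)))
          (weight_mat n (source N) (vec_last (vec_last x d) (n * source N)))))
      (n * target N))"

lemma net_fun_simps [simp]:
  "source (net_fun n N) = net_dim N + (n * n + n * source N)"
  "target (net_fun n N) = n * target N"
  by (simp_all add: net_fun_def Let_def)

lemma body_net_fun:
  assumes "w \<in> carrier_vec (net_dim N)" "a \<in> carrier_vec (n * n)" "x \<in> carrier_vec (n * source N)"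
  shows "body (net_fun n N) (w @\<^sub>v a @\<^sub>v x) = mat_vec n (target N)
    (implementation (body N) w (weight_mat n n a) (weight_mat n (source N) x))"
  using assms by (simp add: net_fun_def Let_def)

lemma net_fun_Arr [simp]:
  assumes N: "N \<in> nets n"
  shows "net_fun n N \<in> Arr Smooth"
proof -
  let ?d = "n * n + n * source N"
  have "Ck k (net_dim N + ?d) (\<lambda>x. implementation (body N) (vec_first x (net_dim N))
          (weight_mat n n (vec_first (vec_last x ?d) (n * n)))
          (weight_mat n (source N) (vec_last (vec_last x ?d) (n * source N))) $$ (i, j))"
    if "i < n" "j < target N" for i j k
  proof (rule Ck_implementation[of _ n "source N" "target N"])
    fix i j assume ij: "i < n" "j < n"
    have "Ck k (net_dim N + ?d) (\<lambda>x. vec_last x ?d $ (i * n + j))"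
      using row_major_less[OF ij] by (intro Ck_vec_last) auto
    then show "Ck k (net_dim N + ?d)
        (\<lambda>x. weight_mat n n (vec_first (vec_last x ?d) (n * n)) $$ (i, j))"
      using ij row_major_less[OF ij] by (simp add: weight_mat_def vec_first_def)
  next
    fix i j assume ij: "i < n" "j < source N"
    \<comment> \<open>The entries of X lie behind the n * n entries of A, whence the offset.\<close>
    have "Ck k (net_dim N + ?d) (\<lambda>x. vec_last x ?d $ (n * n + (i * source N + j)))"
      using row_major_less[OF ij] by (intro Ck_vec_last) auto
    then show "Ck k (net_dim N + ?d)
        (\<lambda>x. weight_mat n (source N) (vec_last (vec_last x ?d) (n * source N)) $$ (i, j))"
      using ij row_major_less[OF ij] by (simp add: weight_mat_def vec_last_def[of _ "n * source N"])
  qed (use N that in \<open>auto simp: nets_iff net_dim_def intro!: Ck_vec_first\<close>)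
  then have "Ck k (net_dim N + ?d) (\<lambda>x. mat_vec n (target N)
        (implementation (body N) (vec_first x (net_dim N))
          (weight_mat n n (vec_first (vec_last x ?d) (n * n)))
          (weight_mat n (source N) (vec_last (vec_last x ?d) (n * source N)))) $ i)"
    if "i < n * target N" for i k
    using that row_major_bounds[OF that] by (simp add: mat_vec_def)
  then show ?thesis
    unfolding Arr_Smooth_iff
    by (simp add: net_fun_def Let_def restrict_smooth_maps)
qed

lemma mat_vec_weight_mat: "x \<in> carrier_vec (k * l) \<Longrightarrow> mat_vec k l (weight_mat k l x) = x"
  by (intro eq_vecI) (auto simp: mat_vec_def weight_mat_def row_major_bounds)

section \<open>The exchange of parameter blocks and pointwise composition\<close>

definition vec_swap :: "nat \<Rightarrow> nat \<Rightarrow> (nat, real vec \<Rightarrow> real vec) arrow"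
  where "vec_swap a b = pairing Smooth (proj2 Smooth a b) (proj1 Smooth a b)"

lemma vec_swap_simps [simp]:
  "vec_swap a b \<in> Arr Smooth" "source (vec_swap a b) = a + b" "target (vec_swap a b) = b + a"
  "u \<in> carrier_vec a \<Longrightarrow> v \<in> carrier_vec b \<Longrightarrow> body (vec_swap a b) (u @\<^sub>v v) = v @\<^sub>v u"
  by (simp_all add: vec_swap_def)

lemma vec_swap_vec_swap: "vec_swap a b ;;\<^bsub>Smooth\<^esub> vec_swap b a = Idn Smooth (a + b)"
  by (rule Smooth_ext) (auto elim!: carrier_vec_addE)

lemma body_para_map_comp1:
  assumes "F \<in> para_cells1 Smooth A" "G \<in> para_cells1 Smooth A" "target F = source G"
    and "q \<in> carrier_vec (para_param G)" "p \<in> carrier_vec (para_param F)"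
    and "a \<in> carrier_vec A" "x \<in> carrier_vec (source F)"
  shows "body (para_map (para_comp1 Smooth A F G)) ((q @\<^sub>v p) @\<^sub>v a @\<^sub>v x) =
    body (para_map G) (q @\<^sub>v a @\<^sub>v body (para_map F) (p @\<^sub>v a @\<^sub>v x))"
proof -
  have "q @\<^sub>v p \<in> carrier_vec (para_param G + para_param F)" "a @\<^sub>v x \<in> carrier_vec (A + source F)"
    "(q @\<^sub>v p) @\<^sub>v a @\<^sub>v x \<in> carrier_vec (para_param G + para_param F + (A + source F))"
    using assms by auto
  then show ?thesis
    using assms by (simp add: Smooth.para_map_comp1 Let_def)
qed

section \<open>The data of the 2-functor\<close>

definition net_cell :: "nat \<Rightarrow> net \<Rightarrow> (nat, real vec \<Rightarrow> real vec) para1"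
  where "net_cell n N = Arrow (n * source N) (net_dim N, net_fun n N) (n * target N)"

lemma net_cell_simps [simp]:
  "source (net_cell n N) = n * source N" "target (net_cell n N) = n * target N"
  "para_param (net_cell n N) = net_dim N" "para_map (net_cell n N) = net_fun n N"
  by (simp_all add: net_cell_def para_param_def para_map_def)

lemma net_cell_cells1 [simp]: "N \<in> nets n \<Longrightarrow> net_cell n N \<in> para_cells1 Smooth (n * n)"
  unfolding Smooth.para_cells1_iff[of "net_cell n N"] by simp

text \<open>The unitor can be an identity map because the empty network and the identity parametric
  map both have parameter space R^0.\<close>

definition network_para :: "nat \<Rightarrow> (nat, layer list, (nat, real vec \<Rightarrow> real vec) arrow,
    nat, nat \<times> (nat, real vec \<Rightarrow> real vec) arrow, (nat, real vec \<Rightarrow> real vec) arrow) bihom"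
  where "network_para n = \<lparr>
    onObj = (\<lambda>k. n * k),
    onCell1 = net_cell n,
    onCell2 = (\<lambda>r. Arrow (net_cell n (source r)) (body r) (net_cell n (target r))),
    compositor = (\<lambda>M N. Arrow (para_comp1 Smooth (n * n) (net_cell n M) (net_cell n N))
      (vec_swap (net_dim N) (net_dim M)) (net_cell n (net_comp M N))),
    unitor = (\<lambda>k. Arrow (para_id1 Smooth (n * n) (n * k)) (Idn Smooth 0)
      (net_cell n (Arrow k [] k)))\<rparr>"

text \<open>Splitting an input into its three blocks reduces the triangle in Para to the pointwise
  condition on 2-cells of networks, applied to the unflattened matrices.\<close>

lemma network_para_cell2:
  assumes r: "r \<in> net_cells2 n"
  shows "Arrow (net_cell n (source r)) (body r) (net_cell n (target r)) \<in> para_cells2 Smooth (n * n)"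
proof -
  have "net_fun n (source r) =
      cross Smooth (body r) (Idn Smooth (n * n + n * source (target r))) ;;\<^bsub>Smooth\<^esub>
        net_fun n (target r)"
  proof (rule Smooth_ext)
    fix y :: "real vec"
    assume "y \<in> carrier_vec (source (cross Smooth (body r)
      (Idn Smooth (n * n + n * source (target r))) ;;\<^bsub>Smooth\<^esub> net_fun n (target r)))"
    then have "y \<in> carrier_vec (net_dim (source r) + (n * n + n * source (target r)))"
      using r by (simp add: net_cells2_iff)
    then obtain w a x where *: "w \<in> carrier_vec (net_dim (source r))" "a \<in> carrier_vec (n * n)"
      "x \<in> carrier_vec (n * source (target r))" "y = w @\<^sub>v a @\<^sub>v x"
      by (metis carrier_vec_addE)
    then have "body (body r) w \<in> carrier_vec (net_dim (target r))"
      using r by (simp add: net_cells2_iff)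
    then show "body (net_fun n (source r)) y =
      body (cross Smooth (body r) (Idn Smooth (n * n + n * source (target r))) ;;\<^bsub>Smooth\<^esub>
        net_fun n (target r)) y"
      using r * by (simp add: net_cells2_iff body_net_fun)
  qed (use r in \<open>simp_all add: net_cells2_iff\<close>)
  then show ?thesis
    using r unfolding Smooth.para_cells2_iff by (simp add: net_cells2_iff)
qed

text \<open>On ((q, p), (a, x)) both sides give the output of \<open>N\<close> with weights q on the
  output of \<open>M\<close> with weights p: one by exchanging blocks and splitting the concatenated
  network, the other by composition in Para.\<close>

lemma compositor_cell_eq:
  assumes M: "M \<in> nets n" and N: "N \<in> nets n" and MN: "target M = source N"
  shows "cross Smooth (vec_swap (net_dim N) (net_dim M))
      (Idn Smooth (n * n + n * source M)) ;;\<^bsub>Smooth\<^esub> net_fun n (net_comp M N) =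
    para_map (para_comp1 Smooth (n * n) (net_cell n M) (net_cell n N))"
    (is "?l = ?r")
proof -
  have r: "para_comp1 Smooth (n * n) (net_cell n M) (net_cell n N) \<in> para_cells1 Smooth (n * n)"
    using assms by simp
  show ?thesis
  proof (rule Smooth_ext)
    fix y :: "real vec" assume "y \<in> carrier_vec (source ?r)"
    then have "y \<in> carrier_vec (net_dim N + net_dim M + (n * n + n * source M))"
      using Smooth.para_cells1D(5)[OF r] by simp
    then obtain q p a x where *: "q \<in> carrier_vec (net_dim N)" "p \<in> carrier_vec (net_dim M)"
      "a \<in> carrier_vec (n * n)" "x \<in> carrier_vec (n * source M)" "y = (q @\<^sub>v p) @\<^sub>v a @\<^sub>v x"
      by (metis carrier_vec_addE)
    define X where "X = implementation (body M) p (weight_mat n n a) (weight_mat n (source M) x)"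
    have X: "X \<in> carrier_mat n (source N)"
      using net_implementation_carrier[OF M, of "weight_mat n n a" "weight_mat n (source M) x" p] MN
      by (simp add: X_def)
    have "body ?l y = body (net_fun n (net_comp M N)) ((p @\<^sub>v q) @\<^sub>v a @\<^sub>v x)"
      using * by simp
    also have "\<dots> = mat_vec n (target N) (implementation (body N) q (weight_mat n n a) X)"
      using * body_net_fun[of "p @\<^sub>v q" "net_comp M N" a n x]
      by (simp add: implementation_append X_def flip: net_dim_def)
    \<comment> \<open>The output of \<open>M\<close> is flattened and at once unflattened again; the
      two cancel because \<open>X\<close> has the right shape.\<close>
    also have "\<dots> = body (net_fun n N) (q @\<^sub>v a @\<^sub>v body (net_fun n M) (p @\<^sub>v a @\<^sub>v x))"
      using * X MN by (simp add: body_net_fun flip: X_def)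
    also have "\<dots> = body ?r y"
      using * assms by (simp add: body_para_map_comp1)
    finally show "body ?l y = body ?r y" .
  qed (use assms Smooth.para_cells1D(4-6)[OF r] in simp_all)
qed

lemma compositor_cell_iso:
  assumes "M \<in> nets n" "N \<in> nets n" "target M = source N"
  shows "Arrow (para_comp1 Smooth (n * n) (net_cell n M) (net_cell n N))
      (vec_swap (net_dim N) (net_dim M)) (net_cell n (net_comp M N)) \<in>
    iso2 (para_cokl Smooth (n * n)) (para_comp1 Smooth (n * n) (net_cell n M) (net_cell n N))
      (net_cell n (net_comp M N))"
  using assms compositor_cell_eq[OF assms]
  by (intro Smooth.para_iso2I[where s = "vec_swap (net_dim M) (net_dim N)"])
    (simp_all add: vec_swap_vec_swap)

text \<open>The empty network unflattens and reflattens its input, so its map is the projection to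
  the features.\<close>

lemma unitor_cell_iso:
  "Arrow (para_id1 Smooth (n * n) (n * k)) (Idn Smooth 0) (net_cell n (Arrow k [] k)) \<in>
    iso2 (para_cokl Smooth (n * n)) (para_id1 Smooth (n * n) (n * k)) (net_cell n (Arrow k [] k))"
proof -
  have "net_fun n (Arrow k [] k) =
      proj2 Smooth 0 (n * n + n * k) ;;\<^bsub>Smooth\<^esub> proj2 Smooth (n * n) (n * k)" (is "?l = ?r")
  proof (rule Smooth_ext)
    fix y :: "real vec" assume "y \<in> carrier_vec (source ?r)"
    then have "y \<in> carrier_vec (0 + (n * n + n * k))"
      by simp
    then obtain w a x where *: "w \<in> carrier_vec 0" "a \<in> carrier_vec (n * n)"
      "x \<in> carrier_vec (n * k)" "y = w @\<^sub>v a @\<^sub>v x"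
      by (metis carrier_vec_addE)
    moreover have "y \<in> carrier_vec (0 + (n * n + n * k))"
      by fact
    ultimately show "body ?l y = body ?r y"
      using body_net_fun[of w "Arrow k [] k" a n x] by (simp add: mat_vec_weight_mat)
  qed simp_all
  then show ?thesis
    by (intro Smooth.para_iso2I[where s = "Idn Smooth 0"]) simp_all
qed

lemma network_para_fields:
  "onObj (network_para n) k = n * k"
  "onCell1 (network_para n) N = net_cell n N"
  "onCell2 (network_para n) r = Arrow (net_cell n (source r)) (body r) (net_cell n (target r))"
  "compositor (network_para n) M N = Arrow (para_comp1 Smooth (n * n) (net_cell n M) (net_cell n N))
      (vec_swap (net_dim N) (net_dim M)) (net_cell n (net_comp M N))"
  "unitor (network_para n) k = Arrow (para_id1 Smooth (n * n) (n * k)) (Idn Smooth 0)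
      (net_cell n (Arrow k [] k))"
  by (simp_all add: network_para_def)

section \<open>Coherence of the block exchange\<close>

lemma vec_swap_natural:
  assumes r: "r \<in> Arr Smooth" and s: "s \<in> Arr Smooth"
  shows "cross Smooth s r ;;\<^bsub>Smooth\<^esub> vec_swap (target s) (target r) =
    vec_swap (source s) (source r) ;;\<^bsub>Smooth\<^esub> cross Smooth r s"
  by (rule Smooth_ext) (use assms in \<open>auto elim!: carrier_vec_addE\<close>)

text \<open>Associativity of the compositor on parameters: both paths send (w, v, u) to (u, v, w).
  The pairing on the right is the associator of Para, and \<open>Idn Smooth (a + b + c)\<close> is
  the image of the associator of networks.\<close>

lemma vec_swap_hexagon:
  "cross Smooth (Idn Smooth c) (vec_swap b a) ;;\<^bsub>Smooth\<^esub>
      (vec_swap c (a + b) ;;\<^bsub>Smooth\<^esub> Idn Smooth (a + b + c)) =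
    pairing Smooth (pairing Smooth (proj1 Smooth c (b + a))
        (proj2 Smooth c (b + a) ;;\<^bsub>Smooth\<^esub> proj1 Smooth b a))
      (proj2 Smooth c (b + a) ;;\<^bsub>Smooth\<^esub> proj2 Smooth b a) ;;\<^bsub>Smooth\<^esub>
    (cross Smooth (vec_swap c b) (Idn Smooth a) ;;\<^bsub>Smooth\<^esub> vec_swap (b + c) a)" (is "?l = ?r")
proof (rule Smooth_ext)
  fix x :: "real vec" assume "x \<in> carrier_vec (source ?r)"
  then have x: "x \<in> carrier_vec (c + (b + a))"
    by simp
  then obtain w v u where "w \<in> carrier_vec c" "v \<in> carrier_vec b" "u \<in> carrier_vec a"
    "x = w @\<^sub>v v @\<^sub>v u"
    by (metis carrier_vec_addE)
  then show "body ?l x = body ?r x"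
    using x body_cross_Smooth[of "w @\<^sub>v v" "vec_swap c b" u "Idn Smooth a"]
      vec_swap_simps(4)[of "v @\<^sub>v w" "b + c" u a]
    by (simp add: append_vec_assoc add.assoc)
qed (simp_all add: add.assoc)

text \<open>Blocks of length 0 are invisible, so the compositors with an identity network and the
  unit cells of Para are all identity maps, and the unit coherences collapse.\<close>

lemma vec_swap_0:
  "vec_swap a 0 = Idn Smooth a" "vec_swap 0 a = Idn Smooth a"
  "proj1 Smooth a 0 = Idn Smooth a" "proj2 Smooth 0 a = Idn Smooth a"
proof -
  have *: "body (vec_swap a 0) x = x" "body (vec_swap 0 a) x = x"
    "vec_first x a = x" "vec_last x a = x"
    if x: "x \<in> carrier_vec a" for x
  proof -
    have nil: "vec 0 (\<lambda>_. 0 :: real) \<in> carrier_vec 0"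
      by simp
    note n = append_vec_carrier_0[OF this]
    show "body (vec_swap a 0) x = x" "body (vec_swap 0 a) x = x"
      using vec_swap_simps(4)[OF x nil] vec_swap_simps(4)[OF nil x] n by simp_all
    show "vec_first x a = x" "vec_last x a = x"
      using vec_first_append[OF x, of "vec 0 (\<lambda>_. 0)"] vec_last_append[OF x, of "vec 0 (\<lambda>_. 0)"] n
      by simp_all
  qed
  show "vec_swap a 0 = Idn Smooth a" "vec_swap 0 a = Idn Smooth a"
    "proj1 Smooth a 0 = Idn Smooth a" "proj2 Smooth 0 a = Idn Smooth a"
    by (rule Smooth_ext; simp add: *)+
qed

lemma pseudofunctor_network_para: "pseudofunctor (GCNN n) (para_cokl Smooth (n * n)) (network_para n)"
proof (intro pseudofunctor.intro bicategory_GCNN Smooth.bicategory_para_cokl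
    pseudofunctor_axioms.intro, goal_cases)
  \<comment> \<open>Goal numbers are shifted by one against the axioms of a pseudofunctor: goal 1 is
    left over from the target bicategory and says that n * n is an object.\<close>
  case (3 f a b)
  then show ?case
    by (auto simp: hom1_GCNN network_para_fields hom1_para_cokl)
next
  case (4 r f g)
  then show ?case
    using network_para_cell2[of r n] by (auto simp: hom2_GCNN network_para_fields hom2_para_cokl)
next
  case (7 f a b g c)
  then show ?case
    using compositor_cell_iso[of f n g] by (auto simp: hom1_GCNN network_para_fields para_cokl_fields GCNN_simps)
next
  case (8 f a b g c r f' s g')
  then show ?case
    using vec_swap_natural[of "body r" "body s"]
    by (auto simp: hom1_GCNN hom2_GCNN network_para_fields para_cokl_fields GCNN_simps net_cells2_iff)
next
  case (9 a)
  then show ?case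
    using unitor_cell_iso[of n a] by (simp add: network_para_fields para_cokl_fields GCNN_simps)
next
  case (10 f a b g c h d)
  then show ?case
    using vec_swap_hexagon[of "net_dim h" "net_dim g" "net_dim f"]
    by (auto simp: hom1_GCNN network_para_fields para_cokl_fields GCNN_simps Smooth.body_para_assoc Let_def
        net_comp_assoc add.assoc)
next
  case (11 f a b)
  then show ?case
    by (auto simp: hom1_GCNN network_para_fields para_cokl_fields GCNN_simps net_comp_id vec_swap_0)
next
  case (12 f a b)
  then show ?case
    by (auto simp: hom1_GCNN network_para_fields para_cokl_fields GCNN_simps net_comp_id vec_swap_0)
qed (auto simp: hom2_GCNN network_para_fields para_cokl_fields GCNN_simps)

theorem theorem1:
  fixes n :: nat
  assumes "n \<ge> 1"
  shows "\<exists>\<kappa>. pseudofunctor (GCNN n) (para_cokl Smooth (n * n)) \<kappa> \<and>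
    injective_on_objects (GCNN n) \<kappa> \<and> faithful (GCNN n) \<kappa>"
proof (intro exI conjI)
  show "pseudofunctor (GCNN n) (para_cokl Smooth (n * n)) (network_para n)"
    by (rule pseudofunctor_network_para)
  show "injective_on_objects (GCNN n) (network_para n)"
    \<comment> \<open>As n is positive, it cancels from n * k = n * l.\<close>
    using assms by (auto simp: injective_on_objects_def network_para_def inj_on_def)
  show "faithful (GCNN n) (network_para n)"
    \<comment> \<open>Within one hom-set the boundaries are fixed and the body is carried over
      unchanged, so equal images have equal bodies.\<close>
    by (auto simp: faithful_def network_para_fields hom2_GCNN intro!: inj_onI arrow.expand)
qed

end
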